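(* Let $0<p\le q$ and $n=p+q$. Consider the following loops: (1) $p_{\alpha,L}(\lambda)=\left(\frac{\lambda-\alpha}{\lambda-\bar\alpha}\right)\pi_L+\pi_{L^\perp}$, where $\alpha\in\mathbb{C}$ and $L$ is a complex line with $\mathbb{C}^n=L\oplus L^\perp$, $L\cap L^\perp=0$; (2) $q_{\alpha,\beta,L}(\lambda)=\left(\frac{\lambda-\alpha}{\lambda-\beta}\right)\pi_L+\pi_{(L\oplus sL)^\perp}+\left(\frac{\lambda-\bar\beta}{\lambda-\bar\alpha}\right)\pi_{sL}$, where $\alpha,\beta\in\mathbb{C}$ and $L$ is an isotropic complex line, with projections taken with respect to $\mathbb{C}^n=L\oplus(L\oplus sL)^\perp\oplus sL$; (3) $m_{\alpha,k,N}(\lambda)=\mathrm{I}+\left(\frac{1}{\lambda-\alpha}\right)^kN$, where $\alpha\in\mathbb{R}$, $k\in\{1,2\}$, $N^2=0$, $N^*=-N$, $\operatorname{rank}N=1$; (4) $n_{\alpha,1,N}(\lambda)=\mathrm{I}+\frac{1}{\lambda-\alpha}N+\frac12\left(\frac{1}{\lambda-\alpha}\right)^{2}N^2$, where $\alpha\in\mathbb{R}$, $N=M-M^*$ with $M:(V\oplus sV)^\perp\to V$ linear for some maximal isotropic subspace $V$, $\operatorname{rank}M=1$, $\operatorname{rank}N=2$. If $p=q$, the rational loop group $\mathcal{L}^-\mathrm{U}_{p,q}$ is generated by the loops (1), (2), (3). If $p\neq q$, it is generated by the loops (1), (2), (3), (4).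
   Context: On $\mathbb{C}^n$, $n=p+q$, let $\langle v,w\rangle=-\sum_{i=1}^p\overline{v_i}w_i+\sum_{i=p+1}^{p+q}\overline{v_i}w_i$. The symbol $\perp$ refers to orthogonality with respect to $\langle\cdot,\cdot\rangle$; a subspace is isotropic if $\langle\cdot,\cdot\rangle$ vanishes identically on it, and maximal isotropic if it is maximal among isotropic subspaces. Put $s=\mathrm{diag}(-\mathrm{I}_p,\mathrm{I}_q)$; $A^*=s\bar A^t s$ is the adjoint with respect to $\langle\cdot,\cdot\rangle$. $\mathcal{L}^-\mathrm{GL}_n\mathbb{C}$ is the group of all non-degenerate (determinant not identically zero) $n\times n$ matrices $g(\lambda)$ of complex rational functions with $g(\infty)=\mathrm{I}$, and $\mathcal{L}^-\mathrm{U}_{p,q}$ is its subgroup of loops satisfying the $\mathrm{U}_{p,q}$-reality condition $(g(\bar\lambda)^* )^{-1}=g(\lambda)$. For isotropic $V$ there is a direct sum decomposition $\mathbb{C}^n=V\oplus(V\oplus sV)^\perp\oplus sV$; a linear map $M:(V\oplus sV)^\perp\to V$ is regarded as an endomorphism of $\mathbb{C}^n$ by extending it by zero on $V\oplus sV$, and $M^*$ is the adjoint of this endomorphism. Projections $\pi$ are onto the indicated summand along the remaining summand(s) of the indicated decomposition. *)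

theory Defs
  imports
    "HOL-Analysis.Analysis"
    "HOL-Computational_Algebra.Computational_Algebra"
    "HOL-Computational_Algebra.Field_as_Ring"
    "HOL-Algebra.Generated_Groups"
begin

text \<open>
  The space \<open>\<complex>\<^sup>n\<close> with \<open>n = p + q\<close> is \<open>complex ^ ('p + 'q)\<close>, where \<open>p = CARD('p)\<close> and
  \<open>q = CARD('q)\<close>: the coordinates \<open>Inl i\<close> are the first \<open>p\<close> ones (negative sign), the coordinates
  \<open>Inr j\<close> the last \<open>q\<close> ones.
\<close>

type_synonym ('p, 'q) cvec = "complex ^ ('p + 'q)"
type_synonym ('p, 'q) cmat = "complex ^ ('p + 'q) ^ ('p + 'q)"

definition hform :: "('p::finite, 'q::finite) cvec \<Rightarrow> ('p, 'q) cvec \<Rightarrow> complex" where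
  "hform v w = - (\<Sum>i\<in>UNIV. cnj (v $ Inl i) * w $ Inl i) + (\<Sum>j\<in>UNIV. cnj (v $ Inr j) * w $ Inr j)"

definition sgn_mat :: "('p::finite, 'q::finite) cmat" where
  "sgn_mat = (\<chi> i j. if i = j then (case i of Inl _ \<Rightarrow> - 1 | Inr _ \<Rightarrow> 1) else 0)"

definition hadj :: "('p::finite, 'q::finite) cmat \<Rightarrow> ('p, 'q) cmat" where
  "hadj A = sgn_mat ** transpose (\<chi> i j. cnj (A $ i $ j)) ** sgn_mat"

definition sgn_image :: "('p::finite, 'q::finite) cvec set \<Rightarrow> ('p, 'q) cvec set" where
  "sgn_image V = (\<lambda>v. sgn_mat *v v) ` V"

definition perp :: "('p::finite, 'q::finite) cvec set \<Rightarrow> ('p, 'q) cvec set" where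
  "perp V = {w. \<forall>v\<in>V. hform v w = 0}"

text \<open>
  Complex subspaces and complex dimension are \<open>vec.subspace\<close> and \<open>vec.dim\<close>; the unqualified
  \<open>subspace\<close> and \<open>dim\<close> would be the real ones. The sum of subspaces is the elementwise
  sum \<open>+\<close> of sets.
\<close>

definition isotropic :: "('p::finite, 'q::finite) cvec set \<Rightarrow> bool" where
  "isotropic V \<longleftrightarrow> vec.subspace V \<and> (\<forall>v\<in>V. \<forall>w\<in>V. hform v w = 0)"

definition maximal_isotropic :: "('p::finite, 'q::finite) cvec set \<Rightarrow> bool" where
  "maximal_isotropic V \<longleftrightarrow> isotropic V \<and> (\<forall>W. isotropic W \<and> V \<subseteq> W \<longrightarrow> W = V)"

definition complex_line :: "('p::finite, 'q::finite) cvec set \<Rightarrow> bool" where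
  "complex_line L \<longleftrightarrow> vec.subspace L \<and> vec.dim L = 1"

text \<open>The projection onto \<open>A\<close> along \<open>B\<close>; meaningful only if \<open>\<complex>\<^sup>n\<close> is the direct sum of \<open>A\<close> and \<open>B\<close>.\<close>

definition proj_along :: "('p::finite, 'q::finite) cvec set \<Rightarrow> ('p, 'q) cvec set \<Rightarrow> ('p, 'q) cmat" where
  "proj_along A B = (THE P. (\<forall>x\<in>A. P *v x = x) \<and> (\<forall>x\<in>B. P *v x = 0))"

type_synonym ratfun = "complex poly fract"
type_synonym ('p, 'q) loop = "ratfun ^ ('p + 'q) ^ ('p + 'q)"

text \<open>
  Evaluation uses the representation in lowest terms, so that poles are exactly the zeros of the
  denominator; the value at a pole is \<open>0\<close> and carries no meaning.
\<close>

definition rat_eval :: "ratfun \<Rightarrow> complex \<Rightarrow> complex" where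
  "rat_eval f z = poly (fst (quot_of_fract f)) z / poly (snd (quot_of_fract f)) z"

definition loop_eval :: "('p::finite, 'q::finite) loop \<Rightarrow> complex \<Rightarrow> ('p, 'q) cmat" where
  "loop_eval g z = (\<chi> i j. rat_eval (g $ i $ j) z)"

definition LGL :: "('p::finite, 'q::finite) loop monoid" where
  "LGL = \<lparr>carrier = {g. det g \<noteq> 0 \<and> (loop_eval g \<longlongrightarrow> mat 1) at_infinity},
          monoid.mult = (**), one = mat 1\<rparr>"

text \<open>
  The reality condition is an identity of matrices of rational functions, i.e. it holds at all but
  finitely many \<open>z\<close> (at the exceptional points one side may have a pole or be singular).
\<close>

definition LU :: "('p::finite, 'q::finite) loop set" where
  "LU = {g \<in> carrier LGL.
          \<forall>\<^sub>F z in cofinite. matrix_inv (hadj (loop_eval g (cnj z))) = loop_eval g z}"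

definition rat_const :: "complex \<Rightarrow> ratfun" where
  "rat_const c = to_fract [:c:]"

definition rat_var :: ratfun where
  "rat_var = to_fract [:0, 1:]"

text \<open>The matrix-valued rational function \<open>f(\<lambda>) A\<close> for a constant matrix \<open>A\<close>.\<close>

definition rat_mult :: "ratfun \<Rightarrow> ('p::finite, 'q::finite) cmat \<Rightarrow> ('p, 'q) loop" where
  "rat_mult f A = (\<chi> i j. f * rat_const (A $ i $ j))"

definition p_loop :: "complex \<Rightarrow> ('p::finite, 'q::finite) cvec set \<Rightarrow> ('p, 'q) loop" where
  "p_loop \<alpha> L =
     rat_mult ((rat_var - rat_const \<alpha>) / (rat_var - rat_const (cnj \<alpha>))) (proj_along L (perp L))
     + rat_mult 1 (proj_along (perp L) L)"

definition p_loops :: "('p::finite, 'q::finite) loop set" where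
  "p_loops = {p_loop \<alpha> L | \<alpha> L. complex_line L \<and> L + perp L = UNIV \<and> L \<inter> perp L = {0}}"

definition q_loop :: "complex \<Rightarrow> complex \<Rightarrow> ('p::finite, 'q::finite) cvec set \<Rightarrow> ('p, 'q) loop" where
  "q_loop \<alpha> \<beta> L =
     (let sL = sgn_image L; W = perp (L + sL) in
       rat_mult ((rat_var - rat_const \<alpha>) / (rat_var - rat_const \<beta>)) (proj_along L (W + sL))
       + rat_mult 1 (proj_along W (L + sL))
       + rat_mult ((rat_var - rat_const (cnj \<beta>)) / (rat_var - rat_const (cnj \<alpha>)))
           (proj_along sL (L + W)))"

definition q_loops :: "('p::finite, 'q::finite) loop set" where
  "q_loops = {q_loop \<alpha> \<beta> L | \<alpha> \<beta> L. complex_line L \<and> isotropic L}"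

definition m_loop :: "real \<Rightarrow> nat \<Rightarrow> ('p::finite, 'q::finite) cmat \<Rightarrow> ('p, 'q) loop" where
  "m_loop \<alpha> k N = mat 1 + rat_mult ((1 / (rat_var - rat_const (of_real \<alpha>))) ^ k) N"

definition m_loops :: "('p::finite, 'q::finite) loop set" where
  "m_loops = {m_loop \<alpha> k N | \<alpha> k N. k \<in> {1, 2} \<and> N ** N = 0 \<and> hadj N = - N \<and> rank N = 1}"

definition n_loop :: "real \<Rightarrow> ('p::finite, 'q::finite) cmat \<Rightarrow> ('p, 'q) loop" where
  "n_loop \<alpha> N =
     mat 1 + rat_mult (1 / (rat_var - rat_const (of_real \<alpha>))) N
     + rat_mult (rat_const (1/2) * (1 / (rat_var - rat_const (of_real \<alpha>))) ^ 2) (N ** N)"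

text \<open>
  \<open>M\<close> is (the matrix of) a linear map from \<open>(V \<oplus> sV)\<^sup>\<bottom>\<close> to \<open>V\<close>, extended by zero on \<open>V \<oplus> sV\<close>.
\<close>

definition perp_to :: "('p::finite, 'q::finite) cvec set \<Rightarrow> ('p, 'q) cmat \<Rightarrow> bool" where
  "perp_to V M \<longleftrightarrow>
     (\<forall>x \<in> perp (V + sgn_image V). M *v x \<in> V) \<and> (\<forall>x \<in> V + sgn_image V. M *v x = 0)"

definition n_loops :: "('p::finite, 'q::finite) loop set" where
  "n_loops = {n_loop \<alpha> (M - hadj M) | \<alpha> M.
     (\<exists>V. maximal_isotropic V \<and> perp_to V M) \<and> rank M = 1 \<and> rank (M - hadj M) = 2}"

end

theory Submission
  imports Defs
begin

text \<open>
  A loop is a unitary matrix over the field \<open>\<complex>(\<lambda>)\<close> with the involution \<open>f(\<lambda>) \<mapsto> cnj (f (cnj \<lambda>))\<close>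
  that reduces to the identity at infinity, i.e. modulo the maximal ideal of the local ring at
  infinity. Hence it lies in the big cell and admits a Gauss decomposition with respect to constant
  hyperbolic pairs \<open>v, s v\<close>. Its torus factors are products of loops of type (2), and its unipotent
  factors are generated by Eichler transformations for constant vectors. Conjugating loops of type
  (3) and (4) by the torus produces all Eichler transformations: those along isotropic vectors
  arise from type (3) by polarization, those along vectors that are orthogonal to a maximal
  isotropic space and its image under \<open>s\<close> from type (4). What remains is a loop in a definite
  unitary group; there, loops of type (1) remove the poles of the columns one at a time.
\<close>

section \<open>Rational functions\<close>

text \<open>Normalization at infinity provides the pivots. For a constant hyperbolic pair u, v with
  <u,v> = 2, the coefficient of g v along v is <u, g v>/2. It tends to 1 because g tends to the
  identity, so it is a nonzero rational function, and all coefficients to be cleared vanish at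
  infinity. Hence the reduction calls only for Eichler transformations with parameters vanishing at
  infinity, and these are the ones that can be generated. The hyperbolic planes have to be treated
  before the poles: a loop of type (1) requires an anisotropic line, but in the indefinite space the
  vector of numerators of a column at a pole may be isotropic. Once all negative coordinate vectors
  are fixed, that vector lies in the positive coordinates, where nonzero vectors have nonzero norm.
  An injection \<open>\<iota>\<close> pairs each negative coordinate with a positive one. If p = q,
  no coordinate is left over. Otherwise an unpaired coordinate vector is orthogonal to V and sV for
  the maximal isotropic V built from the pairs, which is exactly the situation of the loops of type
  (4).\<close>

lemma eventually_poly_nonzero_cofinite:
  assumes "p \<noteq> (0 :: complex poly)"
  shows "\<forall>\<^sub>F z in cofinite. poly p z \<noteq> 0"
  using poly_roots_finite[OF assms] by (simp add: eventually_cofinite)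

lemma eventually_cofinite_cnj:
  assumes "\<forall>\<^sub>F z in cofinite. P z"
  shows "\<forall>\<^sub>F z in cofinite. P (cnj z)"
proof -
  have "{z. \<not> P (cnj z)} = cnj ` {z. \<not> P z}"
    by (auto intro!: image_eqI[of _ _ "cnj _"])
  then show ?thesis using assms by (simp add: eventually_cofinite)
qed

lemma at_infinity_le_cofinite: "at_infinity \<le> (cofinite :: complex filter)"
proof (rule filter_leI)
  fix P :: "complex \<Rightarrow> bool" assume "eventually P cofinite"
  then have "finite {z. \<not> P z}" by (simp add: eventually_cofinite)
  then have "bounded {z. \<not> P z}" by (rule finite_imp_bounded)
  then obtain b where "\<forall>z\<in>{z. \<not> P z}. norm z \<le> b" by (auto simp: bounded_iff)
  then show "eventually P at_infinity"
    unfolding eventually_at_infinity by (intro exI[of _ "b+1"]) force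
qed

lemma rat_eval_quotient:
  assumes "poly b z \<noteq> 0"
  shows "rat_eval (to_fract a / to_fract b) z = poly a z / poly b z"
proof -
  define f where "f = to_fract a / to_fract b"
  define a' b' where "a' = fst (quot_of_fract f)" and "b' = snd (quot_of_fract f)"
  have b: "b \<noteq> 0" using assms by auto
  have b': "b' \<noteq> 0" by (simp add: b'_def)
  have "f = to_fract a' / to_fract b'"
    unfolding a'_def b'_def by (metis Fract_conv_to_fract Fract_quot_of_fract)
  then have "to_fract (a * b') = to_fract (a' * b)"
    using b b' unfolding f_def by (simp add: frac_eq_eq)
  then have eq: "a * b' = a' * b" by (simp only: to_fract_eq_iff)
  have "coprime a' b'" unfolding a'_def b'_def by (rule coprime_quot_of_fract)
  moreover have "b' dvd a' * b" by (metis eq dvd_triv_right)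
  ultimately have "b' dvd b" by (metis coprime_commute coprime_dvd_mult_right_iff)
  then have "poly b' z \<noteq> 0" using assms by (auto elim!: dvdE)
  moreover have "poly a z * poly b' z = poly a' z * poly b z"
    by (metis eq poly_mult)
  ultimately show ?thesis
    unfolding rat_eval_def f_def[symmetric] a'_def[symmetric] b'_def[symmetric]
    using assms by (simp add: field_simps)
qed

lemma ratfun_quotient_cases:
  obtains a b where "b \<noteq> 0" "(f :: ratfun) = to_fract a / to_fract b"
  by (metis Fract_cases Fract_conv_to_fract)

lemma eventually_rat_eval_quotient:
  assumes "b \<noteq> 0"
  shows "\<forall>\<^sub>F z in cofinite. rat_eval (to_fract a / to_fract b) z = poly a z / poly b z"
  using eventually_poly_nonzero_cofinite[OF assms] by eventually_elim (rule rat_eval_quotient)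

lemma rat_eval_add: "\<forall>\<^sub>F z in cofinite. rat_eval (f + g) z = rat_eval f z + rat_eval g z"
proof -
  obtain a b where ab: "b \<noteq> 0" "f = to_fract a / to_fract b" by (rule ratfun_quotient_cases)
  obtain c d where cd: "d \<noteq> 0" "g = to_fract c / to_fract d" by (rule ratfun_quotient_cases)
  have fg: "f + g = to_fract (a * d + c * b) / to_fract (b * d)"
    unfolding ab(2) cd(2) to_fract_add to_fract_mult using ab(1) cd(1) by (intro add_frac_eq) auto
  show ?thesis
    using eventually_poly_nonzero_cofinite[OF ab(1)] eventually_poly_nonzero_cofinite[OF cd(1)]
    unfolding fg unfolding ab(2) cd(2)
    by eventually_elim (simp add: rat_eval_quotient add_frac_eq del: to_fract_mult to_fract_add)
qed

lemma rat_eval_mult: "\<forall>\<^sub>F z in cofinite. rat_eval (f * g) z = rat_eval f z * rat_eval g z"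
proof -
  obtain a b where ab: "b \<noteq> 0" "f = to_fract a / to_fract b" by (rule ratfun_quotient_cases)
  obtain c d where cd: "d \<noteq> 0" "g = to_fract c / to_fract d" by (rule ratfun_quotient_cases)
  have fg: "f * g = to_fract (a * c) / to_fract (b * d)"
    unfolding ab(2) cd(2) to_fract_mult by (rule times_divide_times_eq)
  show ?thesis
    using eventually_poly_nonzero_cofinite[OF ab(1)] eventually_poly_nonzero_cofinite[OF cd(1)]
    unfolding fg unfolding ab(2) cd(2)
    by eventually_elim (simp add: rat_eval_quotient del: to_fract_mult)
qed

lemma rat_eval_to_fract [simp]: "rat_eval (to_fract a) z = poly a z"
  by (simp add: rat_eval_def)

lemma rat_eval_const [simp]: "rat_eval (rat_const c) z = c"
  by (simp add: rat_const_def)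

lemma rat_eval_0 [simp]: "rat_eval 0 z = 0"
  by (simp add: rat_eval_def)

lemma rat_eval_1 [simp]: "rat_eval 1 z = 1"
  by (simp add: rat_eval_def)

lemma rat_eval_sum:
  assumes "finite I"
  shows "\<forall>\<^sub>F z in cofinite. rat_eval (\<Sum>i\<in>I. f i) z = (\<Sum>i\<in>I. rat_eval (f i) z)"
  using assms
proof induction
  case (insert i I)
  show ?case
    using rat_eval_add[of "f i" "\<Sum>i\<in>I. f i"] insert.IH
    by eventually_elim (simp add: insert.hyps)
qed simp

text \<open>Identity theorem: the cross-multiplied difference is a polynomial with infinitely many
  zeros. This turns pointwise identities, valid off a finite set, into identities in the field; the
  laws of \<open>rat_cnj\<close> and the reality condition are obtained in this way.\<close>

lemma ratfun_eqI:
  assumes "\<forall>\<^sub>F z in cofinite. rat_eval f z = rat_eval g z"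
  shows "f = g"
proof -
  obtain a b where ab: "b \<noteq> 0" "f = to_fract a / to_fract b" by (rule ratfun_quotient_cases)
  obtain c d where cd: "d \<noteq> 0" "g = to_fract c / to_fract d" by (rule ratfun_quotient_cases)
  have "\<forall>\<^sub>F z in cofinite. poly (a * d - c * b) z = 0"
    using assms eventually_poly_nonzero_cofinite[OF ab(1)] eventually_poly_nonzero_cofinite[OF cd(1)]
    unfolding ab(2) cd(2)
    by eventually_elim (simp add: rat_eval_quotient frac_eq_eq)
  then have "finite {z. poly (a * d - c * b) z \<noteq> 0}" by (simp add: eventually_cofinite)
  moreover have "{z. poly (a * d - c * b) z \<noteq> 0} \<union> {z. poly (a * d - c * b) z = 0} = UNIV" by blast
  ultimately have "infinite {z. poly (a * d - c * b) z = 0}"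
    using infinite_UNIV_char_0[where 'a=complex] by (metis finite_Un)
  then have "a * d - c * b = 0" using poly_roots_finite by blast
  then have "to_fract a * to_fract d = to_fract c * to_fract b" by (simp flip: to_fract_mult)
  then show ?thesis unfolding ab(2) cd(2) using ab(1) cd(1) by (simp add: frac_eq_eq)
qed

lemma rat_const_add: "rat_const (a + b) = rat_const a + rat_const b"
  by (simp add: rat_const_def flip: to_fract_add)

lemma rat_const_diff: "rat_const (a - b) = rat_const a - rat_const b"
  by (simp add: rat_const_def flip: to_fract_diff)

lemma rat_const_minus: "rat_const (- a) = - rat_const a"
  by (simp add: rat_const_def flip: to_fract_uminus)

lemma rat_const_mult: "rat_const (a * b) = rat_const a * rat_const b"
  by (simp add: rat_const_def flip: to_fract_mult)

lemma rat_const_0 [simp]: "rat_const 0 = 0"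
  by (simp add: rat_const_def)

lemma rat_const_1 [simp]: "rat_const 1 = 1"
  by (simp add: rat_const_def flip: one_pCons)

lemma rat_const_eq_iff [simp]: "rat_const a = rat_const b \<longleftrightarrow> a = b"
  by (simp add: rat_const_def)

lemma rat_const_eq_0_iff [simp]: "rat_const a = 0 \<longleftrightarrow> a = 0"
  by (simp add: rat_const_def)

lemma rat_const_sum: "rat_const (\<Sum>i\<in>I. f i) = (\<Sum>i\<in>I. rat_const (f i))"
  by (induction I rule: infinite_finite_induct) (simp_all add: rat_const_add)

lemma rat_const_numeral [simp]: "rat_const (numeral n) = numeral n"
  by (induction n) (simp_all only: numeral.simps rat_const_add rat_const_1)

lemma ratfun_two_neq_zero [simp]: "(2 :: ratfun) \<noteq> 0"
  by (metis rat_const_eq_0_iff rat_const_numeral zero_neq_numeral)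

lemma ratfun_four_neq_zero [simp]: "(4 :: ratfun) \<noteq> 0"
  by (metis rat_const_eq_0_iff rat_const_numeral zero_neq_numeral)

lemma rat_const_divide: "rat_const (a / b) = rat_const a / rat_const b"
  by (cases "b = 0") (simp_all add: eq_divide_eq flip: rat_const_mult)

text \<open>The involution of the field that extends \<open>cnj\<close> and fixes
  \<open>rat_var\<close>. The reduced fraction only serves to pick a representative.\<close>

definition rat_cnj :: "ratfun \<Rightarrow> ratfun" where
  "rat_cnj f = to_fract (map_poly cnj (fst (quot_of_fract f)))
               / to_fract (map_poly cnj (snd (quot_of_fract f)))"

lemma rat_eval_cnj: "\<forall>\<^sub>F z in cofinite. rat_eval (rat_cnj f) z = cnj (rat_eval f (cnj z))"
proof -
  have "map_poly cnj (snd (quot_of_fract f)) \<noteq> 0"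
    by (simp add: map_poly_eq_0_iff)
  from eventually_rat_eval_quotient[OF this, of "map_poly cnj (fst (quot_of_fract f))"]
  show ?thesis
    unfolding rat_cnj_def by eventually_elim (simp add: rat_eval_def)
qed

lemma rat_cnj_add: "rat_cnj (f + g) = rat_cnj f + rat_cnj g"
proof (rule ratfun_eqI)
  show "\<forall>\<^sub>F z in cofinite. rat_eval (rat_cnj (f + g)) z = rat_eval (rat_cnj f + rat_cnj g) z"
    using rat_eval_cnj[of "f + g"] rat_eval_cnj[of f] rat_eval_cnj[of g]
      rat_eval_add[of "rat_cnj f" "rat_cnj g"] eventually_cofinite_cnj[OF rat_eval_add[of f g]]
    by eventually_elim simp
qed

lemma rat_cnj_mult: "rat_cnj (f * g) = rat_cnj f * rat_cnj g"
proof (rule ratfun_eqI)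
  show "\<forall>\<^sub>F z in cofinite. rat_eval (rat_cnj (f * g)) z = rat_eval (rat_cnj f * rat_cnj g) z"
    using rat_eval_cnj[of "f * g"] rat_eval_cnj[of f] rat_eval_cnj[of g]
      rat_eval_mult[of "rat_cnj f" "rat_cnj g"] eventually_cofinite_cnj[OF rat_eval_mult[of f g]]
    by eventually_elim simp
qed

lemma rat_cnj_cnj [simp]: "rat_cnj (rat_cnj f) = f"
proof (rule ratfun_eqI)
  show "\<forall>\<^sub>F z in cofinite. rat_eval (rat_cnj (rat_cnj f)) z = rat_eval f z"
    using rat_eval_cnj[of "rat_cnj f"] eventually_cofinite_cnj[OF rat_eval_cnj[of f]]
    by eventually_elim simp
qed

lemma rat_cnj_to_fract: "rat_cnj (to_fract p) = to_fract (map_poly cnj p)"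
  by (simp add: rat_cnj_def)

lemma rat_cnj_const [simp]: "rat_cnj (rat_const c) = rat_const (cnj c)"
  by (simp add: rat_cnj_to_fract rat_const_def map_poly_pCons)

lemma rat_cnj_var [simp]: "rat_cnj rat_var = rat_var"
  by (simp add: rat_cnj_to_fract rat_var_def map_poly_pCons)

text \<open>A relation rather than a function: it records both that f lies in the local ring at
  infinity and what its residue class is.\<close>

definition lim_inf :: "ratfun \<Rightarrow> complex \<Rightarrow> bool" where
  "lim_inf f c \<longleftrightarrow> (rat_eval f \<longlongrightarrow> c) at_infinity"

lemma tendsto_at_infinity_cong:
  assumes "\<forall>\<^sub>F z in cofinite. f z = g z" "(g \<longlongrightarrow> (c :: 'b :: topological_space)) at_infinity"
  shows "((f :: complex \<Rightarrow> _) \<longlongrightarrow> c) at_infinity"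
proof -
  have "\<forall>\<^sub>F z in at_infinity. f z = g z"
    using assms(1) at_infinity_le_cofinite by (auto simp: le_filter_def)
  then show ?thesis using assms(2) by (simp add: tendsto_cong)
qed

lemma lim_inf_const: "lim_inf (rat_const c) c"
proof -
  have "rat_eval (rat_const c) = (\<lambda>_. c)" by (rule ext) simp
  then show ?thesis by (simp add: lim_inf_def)
qed

lemma lim_inf_0 [intro]: "lim_inf 0 0"
  using lim_inf_const[of 0] by simp

lemma lim_inf_1 [intro]: "lim_inf 1 1"
  using lim_inf_const[of 1] by simp

lemma lim_inf_add: "lim_inf f a \<Longrightarrow> lim_inf g b \<Longrightarrow> lim_inf (f + g) (a + b)"
  unfolding lim_inf_def by (rule tendsto_at_infinity_cong[OF rat_eval_add]) (rule tendsto_add)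

lemma lim_inf_mult: "lim_inf f a \<Longrightarrow> lim_inf g b \<Longrightarrow> lim_inf (f * g) (a * b)"
  unfolding lim_inf_def by (rule tendsto_at_infinity_cong[OF rat_eval_mult]) (rule tendsto_mult)

lemma lim_inf_uminus: "lim_inf f a \<Longrightarrow> lim_inf (- f) (- a)"
  using lim_inf_mult[OF lim_inf_const[of "-1"], of f a] by (simp add: rat_const_minus)

lemma lim_inf_diff: "lim_inf f a \<Longrightarrow> lim_inf g b \<Longrightarrow> lim_inf (f - g) (a - b)"
  using lim_inf_add[OF _ lim_inf_uminus, of f a g b] by simp

lemma lim_inf_sum: "(\<And>i. i \<in> I \<Longrightarrow> lim_inf (f i) (c i)) \<Longrightarrow> lim_inf (\<Sum>i\<in>I. f i) (\<Sum>i\<in>I. c i)"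
  by (induction I rule: infinite_finite_induct) (auto intro: lim_inf_add)

lemma lim_inf_power: "lim_inf f a \<Longrightarrow> lim_inf (f ^ k) (a ^ k)"
  by (induction k) (auto intro: lim_inf_mult)

lemma lim_inf_unique: "lim_inf f a \<Longrightarrow> lim_inf f b \<Longrightarrow> a = b"
  unfolding lim_inf_def by (rule tendsto_unique[OF trivial_limit_at_infinity])

lemma lim_inf_inverse:
  assumes "lim_inf f a" "a \<noteq> 0"
  shows "lim_inf (inverse f) (inverse a)"
proof -
  have "f \<noteq> 0" using assms lim_inf_unique lim_inf_0 by blast
  then have "f * inverse f = 1" by simp
  then have "\<forall>\<^sub>F z in cofinite. rat_eval f z * rat_eval (inverse f) z = 1"
    using rat_eval_mult[of f "inverse f"] by (simp only: rat_eval_1 eq_commute)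
  then have "\<forall>\<^sub>F z in cofinite. rat_eval (inverse f) z = inverse (rat_eval f z)"
    by eventually_elim (rule inverse_unique[symmetric])
  from tendsto_at_infinity_cong[OF this tendsto_inverse[OF assms(1)[unfolded lim_inf_def] assms(2)]]
  show ?thesis unfolding lim_inf_def .
qed

lemma lim_inf_divide: "lim_inf f a \<Longrightarrow> lim_inf g b \<Longrightarrow> b \<noteq> 0 \<Longrightarrow> lim_inf (f / g) (a / b)"
  using lim_inf_mult[OF _ lim_inf_inverse, of f a g b] by (simp add: divide_inverse)

lemma lim_inf_cnj:
  assumes "lim_inf f a"
  shows "lim_inf (rat_cnj f) (cnj a)"
proof -
  have "filterlim cnj at_infinity at_infinity"
    unfolding filterlim_at_infinity_conv_norm_at_top
    by (simp add: filterlim_norm_at_top)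
  then have "((\<lambda>z. rat_eval f (cnj z)) \<longlongrightarrow> a) at_infinity"
    using assms unfolding lim_inf_def by (rule filterlim_compose[rotated])
  then have "((\<lambda>z. cnj (rat_eval f (cnj z))) \<longlongrightarrow> cnj a) at_infinity"
    by (rule tendsto_cnj)
  then show ?thesis
    unfolding lim_inf_def by (rule tendsto_at_infinity_cong[OF rat_eval_cnj])
qed

lemma lim_inf_poly_quotient:
  assumes "degree p \<le> degree q" "q \<noteq> 0"
  shows "lim_inf (to_fract p / to_fract q) (coeff p (degree q) / lead_coeff q)"
proof (cases "degree p = degree q")
  case True
  let ?n = "degree q"
  have "((\<lambda>x. (poly p x / x ^ ?n) / (poly q x / x ^ ?n)) \<longlongrightarrow> lead_coeff p / lead_coeff q) at_infinity"
    using poly_divide_tendsto_aux[of p] poly_divide_tendsto_aux[of q] assms True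
    by (intro tendsto_divide) auto
  moreover have nz: "\<forall>\<^sub>F z in cofinite. z \<noteq> (0::complex)"
    using eventually_poly_nonzero_cofinite[of "[:0, 1:]"] by simp
  moreover have "\<forall>\<^sub>F z in cofinite. rat_eval (to_fract p / to_fract q) z
                   = (poly p z / z ^ ?n) / (poly q z / z ^ ?n)"
    using eventually_rat_eval_quotient[OF assms(2), of p] nz
    by eventually_elim simp
  ultimately show ?thesis
    unfolding lim_inf_def using True by (auto intro: tendsto_at_infinity_cong)
next
  case False
  then have "degree p < degree q" using assms by simp
  then show ?thesis
    using tendsto_at_infinity_cong[OF eventually_rat_eval_quotient[OF assms(2)]
        poly_divide_tendsto_0_at_infinity]
    by (simp add: lim_inf_def coeff_eq_0)
qed

lemma degree_le_if_lim_inf: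
  assumes "lim_inf (to_fract p / to_fract q) c" "q \<noteq> 0"
  shows "degree p \<le> degree q"
proof (rule ccontr)
  assume less: "\<not> degree p \<le> degree q"
  then have p: "p \<noteq> 0" by auto
  have "lim_inf (to_fract q / to_fract p) 0"
    using lim_inf_poly_quotient[of q p] less p by (simp add: coeff_eq_0)
  from lim_inf_mult[OF this assms(1)] show False
    using p assms(2) lim_inf_unique[OF lim_inf_1] by fastforce
qed

text \<open>The inverse of \<open>rat_var\<close> is a uniformizer at infinity, so a function that
  vanishes there stays regular after division by it. The value c is the coefficient of the simple
  zero.\<close>

lemma lim_inf_var_mult:
  assumes "lim_inf f 0"
  obtains c where "lim_inf (rat_var * f) c"
proof -
  obtain a b where ab: "b \<noteq> 0" "f = to_fract a / to_fract b" by (rule ratfun_quotient_cases)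
  have "degree a \<le> degree b" using assms ab degree_le_if_lim_inf by blast
  moreover have "coeff a (degree b) = 0"
    using lim_inf_unique[OF lim_inf_poly_quotient[OF calculation ab(1)], of 0] assms ab by auto
  \<comment> \<open>Equal degrees would make the leading coefficient of a vanish, so either a = 0 or
    the degree of a is strictly smaller.\<close>
  ultimately have "degree (pCons 0 a) \<le> degree b"
    using ab(1) by (metis degree_0 degree_pCons_eq_if eq_zero_or_degree_less le0 Suc_leI)
  note * = lim_inf_poly_quotient[OF this ab(1)]
  have "pCons 0 a = [:0, 1:] * a" by simp
  then have "to_fract (pCons 0 a) = rat_var * to_fract a" unfolding rat_var_def by (metis to_fract_mult)
  with * show ?thesis using that unfolding ab(2) by (metis times_divide_eq_right)
qed

lemma rat_var_nonzero [simp]: "rat_var \<noteq> 0"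
  by (simp add: rat_var_def)

lemma rat_var_minus_const: "rat_var - rat_const c = to_fract [:- c, 1:]"
  by (simp add: rat_var_def rat_const_def flip: to_fract_diff)

lemma rat_var_minus_const_nonzero [simp]: "rat_var - rat_const c \<noteq> 0" "rat_var \<noteq> rat_const c"
  using rat_var_minus_const[of c] by auto

lemma lim_inf_linear_quotient:
  "lim_inf ((rat_var - rat_const a) / (rat_var - rat_const b)) 1"
  unfolding rat_var_minus_const using lim_inf_poly_quotient[of "[:- a, 1:]" "[:- b, 1:]"] by simp

lemma lim_inf_inverse_linear: "lim_inf (1 / (rat_var - rat_const b)) 0"
  unfolding rat_var_minus_const using lim_inf_poly_quotient[of 1 "[:- b, 1:]"] by simp

lemma lim_inf_inverse_var: "lim_inf (1 / rat_var) 0"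
  using lim_inf_inverse_linear[of 0] by simp

text \<open>By the fundamental theorem of algebra, the factors that occur in the loops of type (2) generate
  the group of all rational functions with value \<open>1\<close> at infinity.\<close>

lemma ratfun_linear_quotient_induct [consumes 1, case_names one mult]:
  assumes "lim_inf h 1" "P 1"
    and mult: "\<And>a b h. lim_inf h 1 \<Longrightarrow> P h \<Longrightarrow> P ((rat_var - rat_const a) / (rat_var - rat_const b) * h)"
  shows "P h"
proof -
  have key: "P (to_fract p / to_fract q)"
    if "degree p = n" "degree q = n" "lead_coeff p = 1" "lead_coeff q = 1" for n p q
    using that
  proof (induction n arbitrary: p q)
    case 0
    then have "p = 1" "q = 1" by (auto simp: one_pCons elim!: degree_eq_zeroE)
    then show ?case using assms(2) by simp
  next
    case (Suc n)
    obtain a where "poly p a = 0" using fundamental_theorem_of_algebra[of p] Suc.prems(1)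
      by (auto simp: constant_degree)
    then obtain p' where p': "p = [:- a, 1:] * p'" by (auto simp: poly_eq_0_iff_dvd)
    obtain b where "poly q b = 0" using fundamental_theorem_of_algebra[of q] Suc.prems(2)
      by (auto simp: constant_degree)
    then obtain q' where q': "q = [:- b, 1:] * q'" by (auto simp: poly_eq_0_iff_dvd)
    have "p' \<noteq> 0" "q' \<noteq> 0" using p' q' Suc.prems by auto
    then have "degree p' = n" "degree q' = n"
      using Suc.prems(1,2) unfolding p' q' by (simp_all add: degree_mult_eq del: mult_pCons_left)
    moreover have "lead_coeff p' = 1" "lead_coeff q' = 1"
      using Suc.prems(3,4) unfolding p' q' lead_coeff_mult by simp_all
    ultimately have *: "degree p' = n" "degree q' = n" "lead_coeff p' = 1" "lead_coeff q' = 1"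
      by auto
    have "lim_inf (to_fract p' / to_fract q') 1"
      using lim_inf_poly_quotient[of p' q'] * \<open>q' \<noteq> 0\<close> by simp
    moreover have "to_fract p / to_fract q
        = (rat_var - rat_const a) / (rat_var - rat_const b) * (to_fract p' / to_fract q')"
      unfolding rat_var_minus_const p' q' by (simp only: to_fract_mult times_divide_times_eq)
    ultimately show ?case using mult[OF _ Suc.IH[OF *]] by (simp only:)
  qed
  obtain p q where pq: "q \<noteq> 0" "h = to_fract p / to_fract q" by (rule ratfun_quotient_cases)
  have le: "degree p \<le> degree q" using assms(1) pq degree_le_if_lim_inf by blast
  have eq: "coeff p (degree q) / lead_coeff q = 1"
    using lim_inf_unique[OF lim_inf_poly_quotient[OF le pq(1)]] assms(1) pq(2) by simp
  then have eq: "coeff p (degree q) = lead_coeff q" using pq(1) by simp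
  then have deg: "degree p = degree q" using le pq(1)
    by (metis le_antisym le_degree leading_coeff_0_iff)
  let ?c = "inverse (lead_coeff q)"
  have c: "?c \<noteq> 0" using pq(1) by simp
  have "P (to_fract (smult ?c p) / to_fract (smult ?c q))"
    using pq(1) eq deg c by (intro key[of _ "degree q"]) auto
  moreover have "to_fract (smult ?c p) / to_fract (smult ?c q) = h"
  proof -
    have "smult ?c p * q = p * smult ?c q" by simp
    then have "to_fract (smult ?c p) * to_fract q = to_fract p * to_fract (smult ?c q)"
      by (metis to_fract_mult)
    then show ?thesis unfolding pq(2) using pq(1) c by (simp add: frac_eq_eq)
  qed
  ultimately show ?thesis by simp
qed

lemma lim_inf_polynomial_constant:
  assumes "lim_inf (to_fract p) c"
  shows "to_fract p = rat_const c"
proof -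
  have "degree p = 0" using degree_le_if_lim_inf[of p 1 c] assms by simp
  then obtain d where "p = [:d:]" by (rule degree_eq_zeroE)
  then show ?thesis using assms lim_inf_const[of d] lim_inf_unique by (auto simp: rat_const_def)
qed

section \<open>Hermitian forms over a field with involution\<close>

text \<open>Polymorphic, because the same signs occur over the constants, the polynomials and the
  rational functions.\<close>

definition sg :: "'p + 'q \<Rightarrow> 'a :: ring_1" where
  "sg k = (case k of Inl _ \<Rightarrow> - 1 | Inr _ \<Rightarrow> 1)"

lemma sg_simps [simp]: "sg (Inl i) = - 1" "sg (Inr j) = 1"
  by (simp_all add: sg_def)

lemma sg_mult_self [simp]: "sg k * sg k = 1" "sg k * (sg k * x) = x"
  by (cases k; simp)+

lemma sg_neq_0 [simp]: "sg k \<noteq> 0"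
  by (cases k) simp_all

text \<open>Interpreted with \<open>cnj\<close> on constants and with \<open>rat_cnj\<close> on
  rational functions, so that each formula is proved once and constant vectors can be compared with
  rational ones.\<close>

locale involution =
  fixes conj :: "'a :: field \<Rightarrow> 'a"
  assumes conj_add: "conj (x + y) = conj x + conj y"
    and conj_mult: "conj (x * y) = conj x * conj y"
    and conj_conj [simp]: "conj (conj x) = x"
    and two_neq_zero [simp]: "(2 :: 'a) \<noteq> 0"
begin

lemma conj_0 [simp]: "conj 0 = 0"
  using conj_add[of 0 0] by (simp only: add_0_left add_cancel_right_right)

lemma conj_minus: "conj (- x) = - conj x"
  by (metis add.right_inverse conj_0 conj_add minus_unique)

lemma conj_diff: "conj (x - y) = conj x - conj y"
  by (metis conj_add conj_minus diff_conv_add_uminus)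

lemma conj_eq_0_iff [simp]: "conj x = 0 \<longleftrightarrow> x = 0"
  by (metis conj_0 conj_conj)

lemma conj_1 [simp]: "conj 1 = 1"
  by (metis conj_conj conj_mult mult.right_neutral mult.left_neutral)

lemma conj_2 [simp]: "conj 2 = 2"
  by (metis conj_1 conj_add one_add_one)

lemma four_neq_zero [simp]: "(4 :: 'a) \<noteq> 0"
  by (metis mult_2 mult_eq_0_iff numeral_Bit0 two_neq_zero)

lemma conj_4 [simp]: "conj 4 = 4"
  by (metis conj_2 conj_add numeral_Bit0)

lemma conj_inverse: "conj (inverse x) = inverse (conj x)"
  by (metis conj_0 conj_1 conj_mult inverse_unique inverse_zero right_inverse)

lemma conj_divide: "conj (x / y) = conj x / conj y"
  by (simp add: divide_inverse conj_mult conj_inverse)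

lemma conj_sum: "conj (\<Sum>i\<in>I. f i) = (\<Sum>i\<in>I. conj (f i))"
  by (induction I rule: infinite_finite_induct) (simp_all add: conj_add)

lemma conj_sg [simp]: "conj (sg k) = sg k"
  by (cases k) (simp_all add: conj_minus)

definition herm :: "'a ^ ('p::finite + 'q::finite) \<Rightarrow> 'a ^ ('p + 'q) \<Rightarrow> 'a" where
  "herm x y = (\<Sum>k\<in>UNIV. sg k * conj (x $ k) * y $ k)"

lemma herm_add_left: "herm (x + y) z = herm x z + herm y z"
  by (simp add: herm_def conj_add algebra_simps sum.distrib)

lemma herm_add_right: "herm z (x + y) = herm z x + herm z y"
  by (simp add: herm_def algebra_simps sum.distrib)

lemma herm_scale_left: "herm (c *s x) z = conj c * herm x z"
  by (simp add: herm_def conj_mult sum_distrib_left mult_ac)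

lemma herm_scale_right: "herm z (c *s x) = c * herm z x"
  by (simp add: herm_def sum_distrib_left mult_ac)

lemma herm_diff_left: "herm (x - y) z = herm x z - herm y z"
  by (simp add: herm_def conj_diff algebra_simps sum_subtractf)

lemma herm_diff_right: "herm z (x - y) = herm z x - herm z y"
  by (simp add: herm_def algebra_simps sum_subtractf)

lemma herm_minus_left: "herm (- x) z = - herm x z"
  by (simp add: herm_def conj_minus sum_negf)

lemma herm_minus_right: "herm z (- x) = - herm z x"
  by (simp add: herm_def sum_negf)

lemma herm_zero [simp]: "herm 0 z = 0" "herm z 0 = 0"
  by (simp_all add: herm_def)

lemmas herm_linear = herm_add_left herm_add_right herm_scale_left herm_scale_right
  herm_diff_left herm_diff_right herm_minus_left herm_minus_right

lemma conj_herm: "conj (herm x y) = herm y x"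
  by (simp add: herm_def conj_sum conj_mult mult_ac)

lemma herm_eq_0_commute: "herm x y = 0 \<longleftrightarrow> herm y x = 0"
  by (metis conj_0 conj_herm)

lemma herm_axis_left: "herm (axis k c) x = sg k * conj c * x $ k"
proof -
  have "herm (axis k c) x = (\<Sum>l\<in>UNIV. if l = k then sg k * conj c * x $ k else 0)"
    unfolding herm_def by (rule sum.cong) (auto simp: axis_def)
  then show ?thesis by simp
qed

lemma herm_axis_right: "herm x (axis k c) = sg k * conj (x $ k) * c"
  using conj_herm[of "axis k c" x, symmetric] by (simp add: herm_axis_left conj_mult)

definition dagger :: "'a ^ ('p::finite + 'q::finite) ^ ('p + 'q) \<Rightarrow> 'a ^ ('p + 'q) ^ ('p + 'q)" where
  "dagger A = (\<chi> i j. sg i * sg j * conj (A $ j $ i))"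

lemma herm_dagger: "herm (dagger A *v x) y = herm x (A *v y)"
proof -
  have "herm (dagger A *v x) y
      = (\<Sum>k\<in>UNIV. \<Sum>j\<in>UNIV. sg j * conj (x $ j) * A $ j $ k * y $ k)"
    by (simp add: herm_def dagger_def matrix_vector_mult_def conj_sum conj_mult
        sum_distrib_left sum_distrib_right mult_ac)
  also have "\<dots> = (\<Sum>j\<in>UNIV. \<Sum>k\<in>UNIV. sg j * conj (x $ j) * A $ j $ k * y $ k)"
    by (rule sum.swap)
  also have "\<dots> = herm x (A *v y)"
    by (simp add: herm_def matrix_vector_mult_def sum_distrib_left mult_ac)
  finally show ?thesis .
qed

lemma dagger_dagger [simp]: "dagger (dagger A) = A"
  by (simp add: dagger_def vec_eq_iff conj_mult mult_ac)

lemma dagger_mult: "dagger (A ** B) = dagger B ** dagger A"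
  by (simp add: dagger_def vec_eq_iff matrix_matrix_mult_def conj_sum conj_mult sum_distrib_left mult_ac)

lemma dagger_mat_1 [simp]: "dagger (mat 1) = mat 1"
  by (auto simp: dagger_def vec_eq_iff mat_def)

lemma dagger_add: "dagger (A + B) = dagger A + dagger B"
  by (simp add: dagger_def vec_eq_iff conj_add algebra_simps)

definition outer :: "'a ^ ('p::finite + 'q::finite) \<Rightarrow> 'a ^ ('p + 'q) \<Rightarrow> 'a ^ ('p + 'q) ^ ('p + 'q)" where
  "outer x y = (\<chi> i j. x $ i * (sg j * conj (y $ j)))"

lemma outer_apply: "outer x y *v z = herm y z *s x"
  by (simp add: outer_def vec_eq_iff matrix_vector_mult_def herm_def sum_distrib_left mult_ac)

lemma dagger_outer: "dagger (outer x y) = outer y x"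
  by (simp add: outer_def dagger_def vec_eq_iff conj_mult mult_ac)

definition unitary :: "'a ^ ('p::finite + 'q::finite) ^ ('p + 'q) \<Rightarrow> bool" where
  "unitary g \<longleftrightarrow> dagger g ** g = mat 1"

lemma herm_unitary:
  assumes "unitary g"
  shows "herm (g *v x) (g *v y) = herm x y"
proof -
  have "herm (g *v x) (g *v y) = herm ((dagger g ** g) *v x) y"
    by (metis dagger_dagger herm_dagger matrix_vector_mul_assoc)
  then show ?thesis using assms by (simp add: unitary_def)
qed

lemma unitary_mult: "unitary g \<Longrightarrow> unitary h \<Longrightarrow> unitary (g ** h)"
  unfolding unitary_def dagger_mult by (metis matrix_mul_assoc matrix_mul_lid)

lemma unitary_dagger: "unitary g \<Longrightarrow> unitary (dagger g)"
  unfolding unitary_def by (simp add: matrix_left_right_inverse)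

lemma unitary_1: "unitary (mat 1)"
  by (simp add: unitary_def)

text \<open>With \<open>u\<close> isotropic, \<open>w\<close> orthogonal to \<open>u\<close> and \<open>conj r = - r\<close>, these are the elements of the
  unipotent radical of the stabilizer of the line spanned by \<open>u\<close>.\<close>

definition eichler :: "'a ^ ('p::finite + 'q::finite) \<Rightarrow> 'a ^ ('p + 'q) \<Rightarrow> 'a \<Rightarrow> 'a ^ ('p + 'q) ^ ('p + 'q)" where
  "eichler u w r = mat 1 + outer u w + outer ((r - herm w w / 2) *s u) u - outer w u"

lemma eichler_apply:
  "eichler u w r *v x = x + (herm w x + (r - herm w w / 2) * herm u x) *s u - herm u x *s w"
  by (simp add: eichler_def outer_apply algebra_simps vec_eq_iff)

text \<open>The group law of a Heisenberg group. Splitting off \<open>herm w w / 2\<close> in the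
  definition makes the cocycle antisymmetric, hence skew under \<open>conj\<close> like r
  itself.\<close>

lemma eichler_mult:
  assumes "herm u u = 0" "herm u w = 0" "herm u w' = 0"
  shows "eichler u w r ** eichler u w' r'
       = eichler u (w + w') (r + r' + (herm w' w - herm w w') / 2)"
proof -
  have "herm w u = 0" "herm w' u = 0" using assms herm_eq_0_commute by blast+
  then show ?thesis
    unfolding matrix_eq matrix_vector_mul_assoc[symmetric] eichler_apply
    by (simp add: herm_linear assms vec_eq_iff field_simps)
qed

lemma eichler_0: "eichler u 0 0 = mat 1"
  unfolding matrix_eq by (simp add: eichler_apply)

lemma eichler_inverse:
  assumes "herm u u = 0" "herm u w = 0"
  shows "eichler u w r ** eichler u (- w) (- r) = mat 1"
    "eichler u (- w) (- r) ** eichler u w r = mat 1"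
  using assms by (simp_all add: eichler_mult herm_linear eichler_0)

text \<open>For w = 0 the transformation adds r <u,x> u, a Hermitian square in u. Expanding this
  square at u + c e and removing the two diagonal terms leaves the mixed ones;
  \<open>conj r = - r\<close> makes them the two halves of one Eichler transformation.\<close>

lemma eichler_polarization:
  assumes "herm u u = 0" "herm e e = 0" "herm u e = 0" "conj r = - r"
  shows "eichler (u + c *s e) 0 r ** eichler u 0 (- r) ** eichler e 0 (- (c * conj c * r))
       = eichler u (- (c * r) *s e) 0"
proof -
  have "herm e u = 0" using assms herm_eq_0_commute by blast
  then show ?thesis
    unfolding matrix_eq matrix_vector_mul_assoc[symmetric] eichler_apply
    by (simp add: herm_linear assms conj_minus conj_mult vec_eq_iff algebra_simps)
qed

text \<open>For a hyperbolic pair this has eigenvalue h on u, 1 on the orthogonal complement of the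
  pair, and on v the eigenvalue \<open>1 / conj h\<close> that unitarity then forces.\<close>

definition torus :: "'a ^ ('p::finite + 'q::finite) \<Rightarrow> 'a ^ ('p + 'q) \<Rightarrow> 'a \<Rightarrow> 'a ^ ('p + 'q) ^ ('p + 'q)" where
  "torus u v h = mat 1 + outer (((h - 1) / herm u v) *s u) v
                       + outer (((1 / conj h - 1) / herm u v) *s v) u"

lemma torus_apply:
  "torus u v h *v x = x + ((h - 1) / herm u v * herm v x) *s u
                        + ((1 / conj h - 1) / herm u v * herm u x) *s v"
  by (simp add: torus_def outer_apply algebra_simps vec_eq_iff)

definition hyperbolic :: "'a ^ ('p::finite + 'q::finite) \<Rightarrow> 'a ^ ('p + 'q) \<Rightarrow> bool" where
  "hyperbolic u v \<longleftrightarrow> herm u u = 0 \<and> herm v v = 0 \<and> herm u v \<noteq> 0 \<and> herm v u = herm u v"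

lemma torus_mult:
  assumes "hyperbolic u v" "h \<noteq> 0" "h' \<noteq> 0"
  shows "torus u v h ** torus u v h' = torus u v (h * h')"
  unfolding matrix_eq matrix_vector_mul_assoc[symmetric] torus_apply
  using assms
  by (simp add: hyperbolic_def herm_linear conj_mult vec_eq_iff divide_simps) (simp add: algebra_simps)

lemma torus_1: "torus u v 1 = mat 1"
  unfolding matrix_eq by (simp add: torus_apply)

lemma torus_fix: "herm u x = 0 \<Longrightarrow> herm v x = 0 \<Longrightarrow> torus u v h *v x = x"
  by (simp add: torus_apply)

lemma torus_scale: "hyperbolic u v \<Longrightarrow> torus u v h *v u = h *s u"
  by (simp add: hyperbolic_def torus_apply vec_eq_iff)

lemma torus_conjugate_eichler:
  assumes "hyperbolic u v" "herm u w = 0" "herm v w = 0" "h \<noteq> 0"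
  shows "torus u v h ** eichler u w r ** torus u v (1 / h) = eichler u (conj h *s w) (h * conj h * r)"
proof -
  have "herm w u = 0" "herm w v = 0" using assms herm_eq_0_commute by blast+
  then show ?thesis
    unfolding matrix_eq matrix_vector_mul_assoc[symmetric] torus_apply eichler_apply
    using assms
    by (simp add: hyperbolic_def herm_linear conj_divide vec_eq_iff divide_simps)
      (simp add: algebra_simps)
qed

text \<open>The quasi-reflection with eigenvalue h on an anisotropic l and 1 on its orthogonal
  complement.\<close>

definition scaling :: "'a ^ ('p::finite + 'q::finite) \<Rightarrow> 'a \<Rightarrow> 'a ^ ('p + 'q) ^ ('p + 'q)" where
  "scaling l h = mat 1 + outer (((h - 1) / herm l l) *s l) l"

lemma scaling_apply: "scaling l h *v x = x + ((h - 1) / herm l l * herm l x) *s l"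
  by (simp add: scaling_def outer_apply algebra_simps vec_eq_iff)

lemma scaling_mult:
  assumes "herm l l \<noteq> 0"
  shows "scaling l h ** scaling l h' = scaling l (h * h')"
  unfolding matrix_eq matrix_vector_mul_assoc[symmetric] scaling_apply using assms
  by (simp add: herm_linear vec_eq_iff divide_simps) (simp add: algebra_simps)

lemma scaling_1: "scaling l 1 = mat 1"
  unfolding matrix_eq by (simp add: scaling_apply)

lemma unitary_scaling:
  assumes "herm l l \<noteq> 0" "h * conj h = 1"
  shows "unitary (scaling l h)"
proof -
  have "h \<noteq> 0" using assms by auto
  then have h: "conj h = 1 / h" using assms by (simp add: field_simps)
  have "dagger (scaling l h) = scaling l (1 / h)"
    using h by (simp add: scaling_def dagger_add dagger_outer)
      (simp add: outer_def vec_eq_iff conj_mult conj_divide conj_diff conj_herm)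
  then show ?thesis unfolding unitary_def using assms \<open>h \<noteq> 0\<close> by (simp add: scaling_mult scaling_1)
qed

lemma unitary_torus:
  assumes "hyperbolic u v" "h \<noteq> 0"
  shows "unitary (torus u v h)"
proof -
  have "dagger (torus u v h) = torus u v (1 / h)"
    using assms conj_herm[of u v] by (simp add: torus_def dagger_add dagger_outer hyperbolic_def)
      (simp add: outer_def vec_eq_iff conj_mult conj_divide conj_diff algebra_simps)
  then show ?thesis unfolding unitary_def using assms by (simp add: torus_mult torus_1)
qed

text \<open>Decompose x = a v + b u + 2a w with w orthogonal to u and v. Since <u,x> = 2a, the
  Eichler transformation along u with this w subtracts exactly 2a w, and r is chosen so that the
  coefficient of u becomes 0. Isotropy of x says that <w,w> is minus the symmetric part of b/a,
  which leaves only a skew part for r.\<close>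

lemma eichler_moves_to_line:
  fixes v u x :: "'a ^ ('p::finite + 'q::finite)"
  assumes "herm v v = 0" "herm u u = 0" "herm v u = 2" "herm x x = 0"
  defines "a \<equiv> herm u x / 2" and "b \<equiv> herm v x / 2"
  defines "w \<equiv> (1 / (2 * a)) *s (x - a *s v - b *s u)"
  defines "r \<equiv> - (b / a + herm w w) / 2"
  assumes "a \<noteq> 0"
  shows "conj r = - r" "herm u w = 0" "herm v w = 0" "eichler u w r *v x = a *s v"
proof -
  have uv: "herm u v = 2" using assms(3) conj_herm[of v u] by simp
  have a: "herm u x = 2 * a" "herm v x = 2 * b" by (simp_all add: a_def b_def)
  have a': "herm x u = 2 * conj a" "herm x v = 2 * conj b"
    using a by (metis conj_2 conj_herm conj_mult)+
  show uw: "herm u w = 0" and vw: "herm v w = 0"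
    unfolding w_def by (simp_all add: herm_linear assms(1-4) uv a)
  have ww: "herm w w = - (b * conj a + a * conj b) / (2 * (a * conj a))"
    unfolding w_def using \<open>a \<noteq> 0\<close> by (simp add: herm_linear assms(1-4) uv a a' conj_divide conj_mult)
      (simp add: field_simps)
  have r: "r = (a * conj b - b * conj a) / (4 * (a * conj a))"
    unfolding r_def ww using \<open>a \<noteq> 0\<close> by (simp add: field_simps)
  show "conj r = - r"
    unfolding r by (simp add: conj_divide conj_diff conj_mult mult_ac minus_divide_left)
  have "herm w x = 2 * a * herm w w"
  proof -
    have "x = (2 * a) *s w + a *s v + b *s u"
      unfolding w_def using \<open>a \<noteq> 0\<close> by (simp add: vec_eq_iff)
    then have "herm w x = herm w ((2 * a) *s w + a *s v + b *s u)" by simp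
    moreover have "herm w u = 0" "herm w v = 0" using uw vw herm_eq_0_commute by blast+
    ultimately show ?thesis by (simp add: herm_linear)
  qed
  then have "herm w x + (r - herm w w / 2) * herm u x = - b"
    using \<open>a \<noteq> 0\<close> unfolding r_def a by (simp add: field_simps)
  then have "eichler u w r *v x = x - b *s u - (2 * a) *s w"
    by (simp add: eichler_apply a)
  also have "\<dots> = a *s v"
    unfolding w_def using \<open>a \<noteq> 0\<close> by (simp add: vec_eq_iff)
  finally show "eichler u w r *v x = a *s v" .
qed

end

section \<open>The rational loop group as a unitary group\<close>

interpretation cplx: involution cnj
  by unfold_locales simp_all

interpretation rat: involution rat_cnj
  by unfold_locales (simp_all add: rat_cnj_add rat_cnj_mult)

lemma hform_eq_herm: "hform x y = cplx.herm x y"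
proof -
  have "cplx.herm x y = (\<Sum>k\<in>UNIV <+> UNIV. sg k * cnj (x $ k) * y $ k)"
    by (simp add: cplx.herm_def)
  also have "\<dots> = hform x y"
    by (subst sum.Plus) (simp_all add: hform_def sum_negf)
  finally show ?thesis by simp
qed

lemma sgn_mat_eq: "sgn_mat = (\<chi> i j. if i = j then sg i else 0)"
  by (auto simp: sgn_mat_def sg_def vec_eq_iff split: sum.split)

lemma hadj_eq_dagger: "hadj A = cplx.dagger A"
  by (simp add: hadj_def cplx.dagger_def sgn_mat_eq vec_eq_iff matrix_matrix_mult_def transpose_def
      if_distrib[of "\<lambda>x. x * _"] if_distrib[of "\<lambda>x. _ * x"] sum.delta sum.delta' mult_ac cong: if_cong)

definition flip :: "complex ^ ('p::finite + 'q::finite) \<Rightarrow> complex ^ ('p + 'q)" where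
  "flip x = (\<chi> k. sg k * x $ k)"

lemma sgn_mat_apply: "sgn_mat *v x = flip x"
  by (simp add: flip_def sgn_mat_eq vec_eq_iff matrix_vector_mult_def
      if_distrib[of "\<lambda>x. x * _"] cong: if_cong)

text \<open>Twisting one argument by s gives the standard positive definite product. Therefore an
  isotropic u and its image \<open>flip u\<close> always form a hyperbolic pair.\<close>

lemma herm_flip: "cplx.herm (flip x) y = (\<Sum>k\<in>UNIV. cnj (x $ k) * y $ k)"
  by (simp add: cplx.herm_def flip_def mult.assoc[symmetric])

lemma herm_flip_flip: "cplx.herm (flip x) (flip y) = cplx.herm x y"
  by (simp add: cplx.herm_def flip_def mult_ac)

lemma herm_flip_self: "cplx.herm (flip x) x = of_real (\<Sum>k\<in>UNIV. (cmod (x $ k))\<^sup>2)"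
  by (simp add: herm_flip complex_norm_square mult.commute del: of_real_power)

lemma herm_flip_self_eq_0_iff: "cplx.herm (flip x) x = 0 \<longleftrightarrow> x = 0"
  unfolding herm_flip_self of_real_eq_0_iff by (subst sum_nonneg_eq_0_iff) (auto simp: vec_eq_iff)

lemma hyperbolic_flip:
  assumes "cplx.herm u u = 0" "u \<noteq> 0"
  shows "cplx.hyperbolic u (flip u)"
proof -
  have "cplx.herm u (flip u) = cplx.herm (flip u) u"
    using cplx.conj_herm[of "flip u" u] by (simp add: herm_flip_self)
  then show ?thesis
    using assms by (simp add: cplx.hyperbolic_def herm_flip_flip herm_flip_self_eq_0_iff)
qed

lemma rat_const_sg [simp]: "rat_const (sg k) = sg k"
  by (cases k) (simp_all add: rat_const_minus)

lemma rat_eval_sg_mult [simp]: "rat_eval (sg i * sg j) z = sg i * sg j"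
  by (metis rat_const_mult rat_const_sg rat_eval_const)

section \<open>Constant vectors and matrices among the rational ones\<close>

definition const_vec :: "complex ^ 'n \<Rightarrow> ratfun ^ 'n" where
  "const_vec x = (\<chi> k. rat_const (x $ k))"

lemma const_vec_add: "const_vec (x + y) = const_vec x + const_vec y"
  by (simp add: const_vec_def vec_eq_iff rat_const_add)

lemma const_vec_scale: "const_vec (c *s x) = rat_const c *s const_vec x"
  by (simp add: const_vec_def vec_eq_iff rat_const_mult)

lemma const_vec_axis: "const_vec (axis k c) = axis k (rat_const c)"
  by (simp add: const_vec_def vec_eq_iff axis_def)

lemma herm_const_vec: "rat.herm (const_vec x) (const_vec y) = rat_const (cplx.herm x y)"
  by (simp add: rat.herm_def cplx.herm_def const_vec_def rat_const_sum rat_const_mult)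

lemma rat_mult_outer: "rat_mult f (cplx.outer x y) = rat.outer (f *s const_vec x) (const_vec y)"
  by (simp add: rat_mult_def cplx.outer_def rat.outer_def const_vec_def vec_eq_iff rat_const_mult mult_ac)

lemma rat_mult_minus: "rat_mult f (- A) = - rat_mult f A"
  by (simp add: rat_mult_def vec_eq_iff rat_const_minus)

lemma rat_mult_diff: "rat_mult f (A - B) = rat_mult f A - rat_mult f B"
  by (simp add: rat_mult_def vec_eq_iff rat_const_diff algebra_simps)

lemma rat_mult_0 [simp]: "rat_mult f 0 = 0"
  by (simp add: rat_mult_def vec_eq_iff)

lemma rat_mult_1_mat_1: "rat_mult 1 (mat 1) = mat 1"
  by (simp add: rat_mult_def vec_eq_iff mat_def)

lemma rat_mult_mult: "rat_mult f A ** rat_mult g B = rat_mult (f * g) (A ** B)"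
  by (simp add: rat_mult_def vec_eq_iff matrix_matrix_mult_def rat_const_sum rat_const_mult
      sum_distrib_left mult_ac)

lemma dagger_rat_mult: "rat.dagger (rat_mult f A) = rat_mult (rat_cnj f) (cplx.dagger A)"
  by (simp add: rat_mult_def rat.dagger_def cplx.dagger_def vec_eq_iff rat_cnj_mult rat_const_mult mult_ac)

definition lim_mat :: "ratfun ^ 'n ^ 'm \<Rightarrow> complex ^ 'n ^ 'm \<Rightarrow> bool" where
  "lim_mat g A \<longleftrightarrow> (\<forall>i j. lim_inf (g $ i $ j) (A $ i $ j))"

lemma lim_mat_add: "lim_mat g A \<Longrightarrow> lim_mat h B \<Longrightarrow> lim_mat (g + h) (A + B)"
  by (simp add: lim_mat_def lim_inf_add)

lemma lim_mat_mult: "lim_mat g A \<Longrightarrow> lim_mat h B \<Longrightarrow> lim_mat (g ** h) (A ** B)"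
  by (simp add: lim_mat_def matrix_matrix_mult_def lim_inf_sum lim_inf_mult)

lemma lim_mat_1: "lim_mat (mat 1) (mat 1)"
  by (auto simp: lim_mat_def mat_def)

lemma lim_mat_rat_mult: "lim_inf f c \<Longrightarrow> lim_mat (rat_mult f A) (\<chi> i j. c * A $ i $ j)"
  by (simp add: lim_mat_def rat_mult_def lim_inf_mult lim_inf_const)

lemma lim_mat_rat_mult_0: "lim_inf f 0 \<Longrightarrow> lim_mat (rat_mult f A) 0"
  using lim_mat_rat_mult[of f 0 A] by (simp add: lim_mat_def)

lemma lim_mat_dagger:
  assumes "lim_mat g A"
  shows "lim_mat (rat.dagger g) (cplx.dagger A)"
  unfolding lim_mat_def
proof (intro allI)
  fix i j
  have "lim_inf (rat_const (sg i * sg j) * rat_cnj (g $ j $ i)) (sg i * sg j * cnj (A $ j $ i))"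
    using assms by (intro lim_inf_mult lim_inf_const lim_inf_cnj) (simp add: lim_mat_def)
  then show "lim_inf (rat.dagger g $ i $ j) (cplx.dagger A $ i $ j)"
    by (simp add: rat.dagger_def cplx.dagger_def rat_const_mult)
qed

lemma lim_mat_iff_tendsto: "lim_mat g (mat 1) \<longleftrightarrow> (loop_eval g \<longlongrightarrow> mat 1) at_infinity"
proof
  assume "lim_mat g (mat 1)"
  then show "(loop_eval g \<longlongrightarrow> mat 1) at_infinity"
    by (intro vec_tendstoI) (simp add: lim_mat_def lim_inf_def loop_eval_def)
next
  assume "(loop_eval g \<longlongrightarrow> mat 1) at_infinity"
  from tendsto_vec_nth[OF tendsto_vec_nth[OF this]]
  show "lim_mat g (mat 1)" by (simp add: lim_mat_def lim_inf_def loop_eval_def)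
qed

lemma eventually_matrix_eq:
  fixes f g :: "'b \<Rightarrow> 'a ^ 'n::finite ^ 'm::finite"
  assumes "\<And>i j. \<forall>\<^sub>F z in F. f z $ i $ j = g z $ i $ j"
  shows "\<forall>\<^sub>F z in F. f z = g z"
  unfolding vec_eq_iff using assms by (intro eventually_all_finite)

lemma loop_eval_mult: "\<forall>\<^sub>F z in cofinite. loop_eval (g ** h) z = loop_eval g z ** loop_eval h z"
proof (rule eventually_matrix_eq)
  fix i j
  have "\<forall>\<^sub>F z in cofinite. \<forall>k. rat_eval (g $ i $ k * h $ k $ j) z
            = rat_eval (g $ i $ k) z * rat_eval (h $ k $ j) z"
    by (intro eventually_all_finite rat_eval_mult)
  with rat_eval_sum[OF finite, of "\<lambda>k. g $ i $ k * h $ k $ j" UNIV]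
  show "\<forall>\<^sub>F z in cofinite. loop_eval (g ** h) z $ i $ j = (loop_eval g z ** loop_eval h z) $ i $ j"
    by eventually_elim (simp add: loop_eval_def matrix_matrix_mult_def)
qed

lemma loop_eval_mat_1: "loop_eval (mat 1) z = mat 1"
  by (simp add: loop_eval_def mat_def vec_eq_iff)

lemma loop_eval_dagger:
  "\<forall>\<^sub>F z in cofinite. loop_eval (rat.dagger g) z = cplx.dagger (loop_eval g (cnj z))"
proof (rule eventually_matrix_eq)
  fix i j
  show "\<forall>\<^sub>F z in cofinite. loop_eval (rat.dagger g) z $ i $ j
          = cplx.dagger (loop_eval g (cnj z)) $ i $ j"
    using rat_eval_mult[of "rat_const (sg i * sg j)" "rat_cnj (g $ j $ i)"] rat_eval_cnj[of "g $ j $ i"]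
    by eventually_elim (simp add: loop_eval_def rat.dagger_def cplx.dagger_def rat_const_mult)
qed

lemma loop_eqI:
  assumes "\<forall>\<^sub>F z in cofinite. loop_eval g z = loop_eval h z"
  shows "g = h"
proof -
  have "g $ i $ j = h $ i $ j" for i j
    by (rule ratfun_eqI, rule eventually_mono[OF assms]) (simp add: loop_eval_def vec_eq_iff)
  then show ?thesis by (simp add: vec_eq_iff)
qed

lemma matrix_inv_eqI:
  assumes "A ** (B :: 'a::field ^ 'n ^ 'n) = mat 1"
  shows "matrix_inv A = B"
proof -
  have BA: "B ** A = mat 1" using assms matrix_left_right_inverse by blast
  have "A ** matrix_inv A = mat 1 \<and> matrix_inv A ** A = mat 1"
    unfolding matrix_inv_def by (rule someI[of _ B]) (simp add: assms BA)
  then show ?thesis by (metis BA matrix_mul_assoc matrix_mul_lid matrix_mul_rid)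
qed

lemma mult_matrix_inv:
  assumes "C ** A = mat 1"
  shows "(A :: 'a::field ^ 'n ^ 'n) ** matrix_inv A = mat 1"
  using assms matrix_inv_eqI matrix_left_right_inverse by metis

text \<open>The adjoint over the rational functions evaluates at z to the complex adjoint of the
  value at \<open>cnj z\<close>, so the reality condition is unitarity with respect to
  \<open>rat_cnj\<close>.\<close>

lemma LU_iff: "g \<in> LU \<longleftrightarrow> lim_mat g (mat 1) \<and> rat.unitary g"
proof
  assume "g \<in> LU"
  then have "det g \<noteq> 0" and lim: "lim_mat g (mat 1)"
    and eq: "\<forall>\<^sub>F z in cofinite. matrix_inv (cplx.dagger (loop_eval g (cnj z))) = loop_eval g z"
    by (simp_all add: LU_def LGL_def lim_mat_iff_tendsto hadj_eq_dagger)
  then obtain h where h: "g ** h = mat 1"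
    by (metis invertible_det_nz invertible_right_inverse)
  then have "rat.dagger h ** rat.dagger g = mat 1"
    by (metis rat.dagger_mat_1 rat.dagger_mult)
  \<comment> \<open>\<open>matrix_inv\<close> is meaningful only at invertible matrices. Evaluating
    an inverse loop shows that the adjoint is invertible at almost all points.\<close>
  then have inv: "\<forall>\<^sub>F z in cofinite. loop_eval (rat.dagger h) z ** loop_eval (rat.dagger g) z = mat 1"
    using loop_eval_mult[of "rat.dagger h" "rat.dagger g"]
    by (auto elim!: eventually_mono simp: loop_eval_mat_1)
  have "\<forall>\<^sub>F z in cofinite. loop_eval (rat.dagger g ** g) z = loop_eval (mat 1) z"
    using eq loop_eval_dagger[of g] loop_eval_mult[of "rat.dagger g" g] inv
  proof eventually_elim
    case (elim z)
    show ?case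
      using mult_matrix_inv[OF elim(4)] elim by (simp add: loop_eval_mat_1)
  qed
  then show "lim_mat g (mat 1) \<and> rat.unitary g"
    using lim loop_eqI unfolding rat.unitary_def by blast
next
  assume *: "lim_mat g (mat 1) \<and> rat.unitary g"
  then have dg: "rat.dagger g ** g = mat 1" by (simp add: rat.unitary_def)
  have "\<forall>\<^sub>F z in cofinite. matrix_inv (cplx.dagger (loop_eval g (cnj z))) = loop_eval g z"
    using loop_eval_dagger[of g] loop_eval_mult[of "rat.dagger g" g]
    by eventually_elim (simp add: dg loop_eval_mat_1 matrix_inv_eqI)
  moreover have "det g \<noteq> 0"
    using * by (metis invertible_det_nz invertible_left_inverse rat.unitary_def)
  ultimately show "g \<in> LU"
    using * by (simp add: LU_def LGL_def lim_mat_iff_tendsto hadj_eq_dagger)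
qed

lemma LU_mult: "g \<in> LU \<Longrightarrow> h \<in> LU \<Longrightarrow> g ** h \<in> LU"
  using lim_mat_mult[of g "mat 1" h "mat 1"] by (simp add: LU_iff rat.unitary_mult)

lemma LU_dagger: "g \<in> LU \<Longrightarrow> rat.dagger g \<in> LU"
  using lim_mat_dagger[of g "mat 1"] by (simp add: LU_iff rat.unitary_dagger)

lemma LU_1: "mat 1 \<in> LU"
  by (simp add: LU_iff lim_mat_1 rat.unitary_1)

text \<open>The inverse in the monoid is a definite description, so uniqueness is checked along with
  existence.\<close>

lemma inv_LGL:
  assumes "g \<in> LU"
  shows "inv\<^bsub>LGL\<^esub> g = rat.dagger g"
  unfolding m_inv_def
proof (rule the_equality)
  have 1: "rat.dagger g ** g = mat 1" using assms by (simp add: LU_iff rat.unitary_def)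
  then have 2: "g ** rat.dagger g = mat 1" by (simp add: matrix_left_right_inverse)
  show "rat.dagger g \<in> carrier LGL \<and> g \<otimes>\<^bsub>LGL\<^esub> rat.dagger g = \<one>\<^bsub>LGL\<^esub> \<and> rat.dagger g \<otimes>\<^bsub>LGL\<^esub> g = \<one>\<^bsub>LGL\<^esub>"
    using LU_dagger[OF assms] 1 2 by (simp add: LU_def) (simp add: LGL_def)
  show "h = rat.dagger g" if "h \<in> carrier LGL \<and> g \<otimes>\<^bsub>LGL\<^esub> h = \<one>\<^bsub>LGL\<^esub> \<and> h \<otimes>\<^bsub>LGL\<^esub> g = \<one>\<^bsub>LGL\<^esub>" for h
  proof -
    have gh: "g ** h = mat 1" using that by (simp add: LGL_def)
    have "h = (rat.dagger g ** g) ** h" using 1 by simp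
    also have "\<dots> = rat.dagger g" by (simp add: matrix_mul_assoc[symmetric] gh)
    finally show ?thesis .
  qed
qed

lemma LGL_simps [simp]: "g \<otimes>\<^bsub>LGL\<^esub> h = g ** h" "\<one>\<^bsub>LGL\<^esub> = mat 1"
  by (simp_all add: LGL_def)

lemma generate_subset_LU:
  assumes "S \<subseteq> LU"
  shows "generate LGL S \<subseteq> LU"
proof
  fix g assume "g \<in> generate LGL S"
  then show "g \<in> LU"
  proof induction
    case one then show ?case using LU_1 by simp
  next
    case (incl h) then show ?case using assms by blast
  next
    case (inv h)
    then have "h \<in> LU" using assms by blast
    then show ?case by (simp add: inv_LGL LU_dagger)
  next
    case (eng h1 h2) then show ?case using LU_mult by simp
  qed
qed

lemma generate_LGL_one: "mat 1 \<in> generate LGL S"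
  unfolding LGL_simps(2)[symmetric] by (rule generate.one)

lemma generate_LGL_mult: "g \<in> generate LGL S \<Longrightarrow> h \<in> generate LGL S \<Longrightarrow> g ** h \<in> generate LGL S"
  unfolding LGL_simps(1)[symmetric] by (rule generate.eng)

section \<open>The generating loops\<close>

lemma proj_alongI:
  assumes "\<And>x. x \<in> A \<Longrightarrow> P *v x = x" "\<And>x. x \<in> B \<Longrightarrow> P *v x = 0" "A + B = UNIV"
  shows "proj_along A B = P"
  unfolding proj_along_def
proof (rule the_equality)
  show "(\<forall>x\<in>A. P *v x = x) \<and> (\<forall>x\<in>B. P *v x = 0)" using assms by blast
  fix Q assume Q: "(\<forall>x\<in>A. Q *v x = x) \<and> (\<forall>x\<in>B. Q *v x = 0)"
  have "Q *v x = P *v x" for x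
  proof -
    have "x \<in> A + B" using assms(3) by simp
    then obtain a b where "a \<in> A" "b \<in> B" "x = a + b" by (rule set_plus_elim)
    then show ?thesis using Q assms(1,2) by (simp add: matrix_vector_right_distrib)
  qed
  then show "Q = P" by (simp add: matrix_eq)
qed

lemma complex_lineE:
  assumes "complex_line L"
  obtains l where "l \<noteq> 0" "L = range (\<lambda>c. c *s l)"
proof -
  have L: "vec.subspace L" "vec.dim L = 1" using assms by (simp_all add: complex_line_def)
  obtain B where B: "B \<subseteq> L" "vec.independent B" "L \<subseteq> vec.span B" "card B = vec.dim L"
    using vec.basis_exists[of L] by blast
  then obtain l where l: "B = {l}" using L(2) by (metis card_1_singletonE)
  have "l \<noteq> 0" using B(2) l vec.dependent_zero by blast
  moreover have "L = vec.span {l}"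
    using B(1,3) l L(1) vec.span_minimal by blast
  ultimately show ?thesis using that by (simp add: vec.span_singleton)
qed

lemma complex_line_range:
  assumes "l \<noteq> 0"
  shows "complex_line (range (\<lambda>c. c *s l))"
  using assms unfolding complex_line_def vec.span_singleton[symmetric] by simp

lemma perp_range: "perp (range (\<lambda>c. c *s l)) = {x. cplx.herm l x = 0}"
  by (auto simp: perp_def hform_eq_herm cplx.herm_linear dest: spec[of _ 1])

lemma range_plus_perp:
  assumes "cplx.herm l l \<noteq> 0"
  shows "range (\<lambda>c. c *s l) + perp (range (\<lambda>c. c *s l)) = UNIV"
proof -
  have "x \<in> range (\<lambda>c. c *s l) + perp (range (\<lambda>c. c *s l))" for x
  proof -
    define c where "c = cplx.herm l x / cplx.herm l l"
    have "x - c *s l \<in> perp (range (\<lambda>c. c *s l))"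
      using assms by (simp add: perp_range cplx.herm_linear c_def)
    then have "c *s l + (x - c *s l) \<in> range (\<lambda>c. c *s l) + perp (range (\<lambda>c. c *s l))"
      by (intro set_plus_intro) auto
    then show ?thesis by simp
  qed
  then show ?thesis by blast
qed

lemma p_loop_eq_scaling:
  assumes "cplx.herm l l \<noteq> 0"
  shows "p_loop \<alpha> (range (\<lambda>c. c *s l))
    = rat.scaling (const_vec l) ((rat_var - rat_const \<alpha>) / (rat_var - rat_const (cnj \<alpha>)))"
proof -
  let ?L = "range (\<lambda>c. c *s l)"
  define P where "P = cplx.outer ((1 / cplx.herm l l) *s l) l"
  have 1: "proj_along ?L (perp ?L) = P"
    by (rule proj_alongI)
      (use assms range_plus_perp[OF assms] in \<open>auto simp: P_def cplx.outer_apply perp_range cplx.herm_linear\<close>)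
  define h where "h = (rat_var - rat_const \<alpha>) / (rat_var - rat_const (cnj \<alpha>))"
  have 2: "proj_along (perp ?L) ?L = mat 1 - P"
    by (rule proj_alongI)
      (use assms range_plus_perp[OF assms] in \<open>auto simp: P_def cplx.outer_apply perp_range
        cplx.herm_linear matrix_vector_mult_diff_rdistrib add.commute\<close>)
  show ?thesis
    unfolding p_loop_def h_def[symmetric] 1 2 rat_mult_diff rat_mult_1_mat_1 unfolding P_def rat_mult_outer
    by (simp add: rat.scaling_def rat.outer_def const_vec_scale herm_const_vec vec_eq_iff
        rat_const_divide algebra_simps diff_divide_distrib)
qed

lemma p_loops_eq:
  "p_loops = {rat.scaling (const_vec l) ((rat_var - rat_const \<alpha>) / (rat_var - rat_const (cnj \<alpha>)))
              | \<alpha> l. cplx.herm l l \<noteq> 0}"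
proof (intro equalityI subsetI)
  fix g :: "('p::finite, 'q::finite) loop" assume "g \<in> p_loops"
  then obtain \<alpha> L where L: "complex_line L" "L \<inter> perp L = {0}" and g: "g = p_loop \<alpha> L"
    by (auto simp: p_loops_def)
  obtain l where l: "l \<noteq> 0" "L = range (\<lambda>c. c *s l)" using complex_lineE[OF L(1)] .
  have "cplx.herm l l \<noteq> 0"
  proof
    assume "cplx.herm l l = 0"
    then have "l \<in> perp L" by (simp add: l(2) perp_range)
    moreover have "l \<in> L" unfolding l(2) by (rule range_eqI[of _ _ 1]) simp
    ultimately show False using L(2) l(1) by blast
  qed
  then show "g \<in> {rat.scaling (const_vec l) ((rat_var - rat_const \<alpha>) / (rat_var - rat_const (cnj \<alpha>)))
              | \<alpha> l. cplx.herm l l \<noteq> 0}"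
    unfolding g l(2) using p_loop_eq_scaling by blast
next
  fix g :: "('p::finite, 'q::finite) loop"
  assume "g \<in> {rat.scaling (const_vec l) ((rat_var - rat_const \<alpha>) / (rat_var - rat_const (cnj \<alpha>)))
              | \<alpha> l. cplx.herm l l \<noteq> 0}"
  then obtain \<alpha> and l :: "('p, 'q) cvec" where l: "cplx.herm l l \<noteq> 0"
    and g: "g = p_loop \<alpha> (range (\<lambda>c. c *s l))"
    using p_loop_eq_scaling by fastforce
  moreover have "range (\<lambda>c. c *s l) \<inter> perp (range (\<lambda>c. c *s l)) = {0}"
    using l by (auto simp: perp_range cplx.herm_linear intro: range_eqI[of _ _ 0])
  moreover have "complex_line (range (\<lambda>c. c *s l))" using l by (intro complex_line_range) auto
  ultimately show "g \<in> p_loops"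
    unfolding p_loops_def using range_plus_perp[OF l] by blast
qed

lemma q_loop_eq_torus:
  assumes "cplx.herm u u = 0" "u \<noteq> 0"
  shows "q_loop \<alpha> \<beta> (range (\<lambda>c. c *s u))
    = rat.torus (const_vec u) (const_vec (flip u)) ((rat_var - rat_const \<alpha>) / (rat_var - rat_const \<beta>))"
proof -
  let ?L = "range (\<lambda>c. c *s u)" and ?S = "range (\<lambda>c. c *s flip u)"
  define d where "d = cplx.herm u (flip u)"
  have "cplx.hyperbolic u (flip u)" using assms by (rule hyperbolic_flip)
  then have d: "d \<noteq> 0" "cplx.herm (flip u) u = d" "cplx.herm u (flip u) = d"
      "cplx.herm (flip u) (flip u) = 0"
    by (simp_all add: cplx.hyperbolic_def d_def)
  have S: "sgn_image ?L = ?S"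
    unfolding sgn_image_def image_image sgn_mat_apply
    by (simp add: flip_def vec_eq_iff mult_ac cong: image_cong)
      (simp add: vector_scalar_mult_def mult_ac)
  define W where "W = perp (?L + ?S)"
  have W: "W = {x. cplx.herm u x = 0 \<and> cplx.herm (flip u) x = 0}"
  proof -
    have "1 *s u + 0 *s flip u \<in> ?L + ?S" "0 *s u + 1 *s flip u \<in> ?L + ?S"
      by (intro set_plus_intro rangeI)+
    then have "u \<in> ?L + ?S" "flip u \<in> ?L + ?S" by simp_all
    then show ?thesis
      unfolding W_def perp_def hform_eq_herm
      by (auto simp: set_plus_def cplx.herm_linear)
  qed
  have dec: "?L + (W + ?S) = UNIV"
  proof -
    have "x \<in> ?L + (W + ?S)" for x
    proof -
      define a b where "a = cplx.herm (flip u) x / d" and "b = cplx.herm u x / d"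
      have "x - a *s u - b *s flip u \<in> W"
        using d assms(1) by (simp add: W cplx.herm_linear a_def b_def)
      then have "a *s u + ((x - a *s u - b *s flip u) + b *s flip u) \<in> ?L + (W + ?S)"
        by (intro set_plus_intro) auto
      then show ?thesis by simp
    qed
    then show ?thesis by blast
  qed
  have dec2: "W + (?L + ?S) = UNIV" and dec3: "?S + (?L + W) = UNIV"
    using dec by (simp_all add: ac_simps)
  define P where "P = cplx.outer ((1 / d) *s u) (flip u)"
  define Q where "Q = cplx.outer ((1 / d) *s flip u) u"
  have 1: "proj_along ?L (W + ?S) = P"
    by (rule proj_alongI[OF _ _ dec])
      (use d assms in \<open>auto simp: P_def cplx.outer_apply W cplx.herm_linear set_plus_def\<close>)
  have 2: "proj_along ?S (?L + W) = Q"
    by (rule proj_alongI[OF _ _ dec3])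
      (use d assms in \<open>auto simp: Q_def cplx.outer_apply W cplx.herm_linear set_plus_def\<close>)
  have 3: "proj_along W (?L + ?S) = mat 1 - P - Q"
    by (rule proj_alongI[OF _ _ dec2])
      (use d assms in \<open>auto simp: P_def Q_def cplx.outer_apply W cplx.herm_linear set_plus_def
        matrix_vector_mult_diff_rdistrib\<close>)
  define h h' where "h = (rat_var - rat_const \<alpha>) / (rat_var - rat_const \<beta>)"
    and "h' = (rat_var - rat_const (cnj \<beta>)) / (rat_var - rat_const (cnj \<alpha>))"
  \<comment> \<open>The third coefficient of \<open>q_loop\<close> is the eigenvalue that a torus
    element must have on \<open>flip u\<close>.\<close>
  have h: "1 / rat_cnj h = h'"
    by (simp add: h_def h'_def rat.conj_divide rat.conj_diff)
  show ?thesis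
    unfolding q_loop_def Let_def S W_def[symmetric] 1 2 3 rat_mult_diff rat_mult_1_mat_1
      rat.torus_def h_def[symmetric] h'_def[symmetric] h
    unfolding P_def Q_def rat_mult_outer
    by (simp add: rat.outer_def const_vec_scale herm_const_vec vec_eq_iff d
        rat_const_divide algebra_simps diff_divide_distrib)
qed

lemma isotropic_range: "isotropic (range (\<lambda>c. c *s u)) \<longleftrightarrow> cplx.herm u u = 0"
proof -
  have "vec.subspace (range (\<lambda>c. c *s u))" by (simp flip: vec.span_singleton)
  then show ?thesis
    by (auto simp: isotropic_def hform_eq_herm cplx.herm_linear dest!: spec[of _ 1])
qed

lemma q_loops_eq:
  "q_loops = {rat.torus (const_vec u) (const_vec (flip u))
      ((rat_var - rat_const \<alpha>) / (rat_var - rat_const \<beta>)) | \<alpha> \<beta> u. u \<noteq> 0 \<and> cplx.herm u u = 0}"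
proof (intro equalityI subsetI)
  fix g :: "('p::finite, 'q::finite) loop" assume "g \<in> q_loops"
  then obtain \<alpha> \<beta> L where L: "complex_line L" "isotropic L" and g: "g = q_loop \<alpha> \<beta> L"
    by (auto simp: q_loops_def)
  obtain l where l: "l \<noteq> 0" "L = range (\<lambda>c. c *s l)" using complex_lineE[OF L(1)] .
  have "cplx.herm l l = 0" using L(2) l(2) isotropic_range by blast
  then show "g \<in> {rat.torus (const_vec u) (const_vec (flip u))
      ((rat_var - rat_const \<alpha>) / (rat_var - rat_const \<beta>)) | \<alpha> \<beta> u. u \<noteq> 0 \<and> cplx.herm u u = 0}"
    unfolding g l(2) using q_loop_eq_torus l(1) by blast
next
  fix g :: "('p::finite, 'q::finite) loop"
  assume "g \<in> {rat.torus (const_vec u) (const_vec (flip u))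
      ((rat_var - rat_const \<alpha>) / (rat_var - rat_const \<beta>)) | \<alpha> \<beta> u. u \<noteq> 0 \<and> cplx.herm u u = 0}"
  then obtain \<alpha> \<beta> and u :: "('p, 'q) cvec" where u: "u \<noteq> 0" "cplx.herm u u = 0"
    and g: "g = rat.torus (const_vec u) (const_vec (flip u))
      ((rat_var - rat_const \<alpha>) / (rat_var - rat_const \<beta>))" by blast
  show "g \<in> q_loops"
    unfolding g q_loop_eq_torus[OF u(2,1), symmetric] q_loops_def
    using complex_line_range[OF u(1)] u(2) isotropic_range by blast
qed

section \<open>Eichler transformations among the loops of types (3) and (4); \<open>sg_cnj y\<close>
  is the covector of the form at y, which spans the rows of rank one operators\<close>

definition sg_cnj :: "complex ^ ('p::finite + 'q::finite) \<Rightarrow> complex ^ ('p + 'q)" where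
  "sg_cnj y = (\<chi> j. sg j * cnj (y $ j))"

lemma row_outer: "row k (cplx.outer x y) = x $ k *s sg_cnj y"
  by (simp add: row_def cplx.outer_def sg_cnj_def vec_eq_iff)

lemma sg_cnj_eq_0_iff [simp]: "sg_cnj y = 0 \<longleftrightarrow> y = 0"
  by (simp add: sg_cnj_def vec_eq_iff)

lemma rank_outer:
  assumes "x \<noteq> 0" "y \<noteq> 0"
  shows "rank (cplx.outer x y) = 1"
proof -
  obtain k where k: "x $ k \<noteq> 0" using assms(1) by (auto simp: vec_eq_iff)
  have "vec.span (rows (cplx.outer x y)) = vec.span {sg_cnj y}"
  proof (rule vec.span_eq[THEN iffD2], intro conjI)
    show "rows (cplx.outer x y) \<subseteq> vec.span {sg_cnj y}"
      by (auto simp: rows_def row_outer intro: vec.span_scale vec.span_base)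
    have "(1 / x $ k) *s row k (cplx.outer x y) \<in> vec.span (rows (cplx.outer x y))"
      by (intro vec.span_scale vec.span_base) (auto simp: rows_def)
    then show "{sg_cnj y} \<subseteq> vec.span (rows (cplx.outer x y))"
      using k by (simp add: row_outer vec_eq_iff)
  qed
  then have "rank (cplx.outer x y) = vec.dim {sg_cnj y}"
    unfolding row_rank_def_gen by (rule vec.span_eq_dim)
  then show ?thesis using assms(2) by simp
qed

text \<open>For N a multiple of the rank one operator of u with itself, N has square zero because u
  is isotropic, and the adjoint is -N exactly for an imaginary multiple.\<close>

lemma eichler_in_m_loops:
  assumes "cplx.herm u u = 0" "u \<noteq> 0" "c \<noteq> 0"
  shows "rat.eichler (const_vec u) 0 (rat_const (\<i> * of_real c) / rat_var) \<in> m_loops"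
proof -
  let ?N = "cplx.outer ((\<i> * of_real c) *s u) u"
  have "?N ** ?N = 0"
    unfolding matrix_eq matrix_vector_mul_assoc[symmetric] cplx.outer_apply
    using assms(1) by (simp add: cplx.herm_linear)
  moreover have "hadj ?N = - ?N"
    unfolding hadj_eq_dagger cplx.dagger_outer by (simp add: cplx.outer_def vec_eq_iff)
  moreover have "rank ?N = 1" using assms by (intro rank_outer) auto
  moreover have "rat.eichler (const_vec u) 0 (rat_const (\<i> * of_real c) / rat_var) = m_loop 0 1 ?N"
    unfolding m_loop_def rat_mult_outer
    by (simp add: rat.eichler_def rat.outer_def vec_eq_iff const_vec_scale mult_ac)
  ultimately show ?thesis
    unfolding m_loops_def by (intro CollectI exI[of _ 0] exI[of _ "1::nat"] exI[of _ ?N]) simp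
qed


lemma const_vec_minus: "const_vec (- x) = - const_vec x"
  by (simp add: const_vec_def vec_eq_iff rat_const_minus)

lemma matrix_vector_mult_minus_right: "(A :: 'a::comm_ring_1 ^ 'n ^ 'm) *v (- x) = - (A *v x)"
  by (simp add: matrix_vector_mult_def vec_eq_iff sum_negf)

text \<open>With \<open>\<epsilon>\<close> equal to 1 and -1, these two isotropic vectors span the
  hyperbolic plane of the coordinates \<open>Inl i\<close> and \<open>Inr (\<iota> i)\<close>, and s
  exchanges them.\<close>

definition block :: "('p \<Rightarrow> 'q) \<Rightarrow> complex \<Rightarrow> 'p \<Rightarrow> complex ^ ('p::finite + 'q::finite)" where
  "block \<iota> \<epsilon> i = axis (Inl i) \<epsilon> + axis (Inr (\<iota> i)) 1"

lemma herm_block: "\<epsilon> \<in> {1, - 1} \<Longrightarrow> cplx.herm (block \<iota> \<epsilon> i) x = x $ Inr (\<iota> i) - \<epsilon> * x $ Inl i"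
  by (auto simp: block_def cplx.herm_linear cplx.herm_axis_left)

definition block_space :: "('p \<Rightarrow> 'q) \<Rightarrow> complex \<Rightarrow> (complex ^ ('p::finite + 'q::finite)) set" where
  "block_space \<iota> \<epsilon> = {x. (\<forall>k. x $ Inl k = \<epsilon> * x $ Inr (\<iota> k)) \<and> (\<forall>j. j \<notin> range \<iota> \<longrightarrow> x $ Inr j = 0)}"

lemma block_in_block_space:
  assumes "inj \<iota>"
  shows "block \<iota> \<epsilon> i \<in> block_space \<iota> \<epsilon>"
  using assms by (auto simp: block_space_def block_def axis_def inj_eq)

text \<open>A vector of a larger isotropic space is orthogonal to every block, which ties its paired
  coordinates together and cancels their contribution to <x,x>. What remains is a positive sum over
  the unpaired coordinates, so these vanish.\<close>

lemma maximal_isotropic_block_space: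
  fixes \<iota> :: "'p::finite \<Rightarrow> 'q::finite"
  assumes "inj \<iota>" and \<epsilon>: "\<epsilon> \<in> {1, - 1}"
  shows "maximal_isotropic (block_space \<iota> \<epsilon>)"
proof -
  have split: "(\<Sum>j\<in>UNIV. f j) = (\<Sum>k\<in>UNIV. f (\<iota> k)) + (\<Sum>j\<in>- range \<iota>. f j)"
    for f :: "'q \<Rightarrow> complex"
  proof -
    have "(\<Sum>j\<in>UNIV. f j) = sum f (range \<iota>) + sum f (- range \<iota>)"
      by (subst sum.union_disjoint[symmetric]) auto
    then show ?thesis by (simp add: sum.reindex[OF assms(1)])
  qed
  have "isotropic (block_space \<iota> \<epsilon>)"
    unfolding isotropic_def
  proof (intro conjI ballI)
    show "vec.subspace (block_space \<iota> \<epsilon>)"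
      by (rule vec.subspaceI) (auto simp: block_space_def algebra_simps)
    fix x y assume "x \<in> block_space \<iota> \<epsilon>" "y \<in> block_space \<iota> \<epsilon>"
    then show "hform x y = 0"
      unfolding hform_def split using \<epsilon> by (auto simp: block_space_def)
  qed
  moreover have "W = block_space \<iota> \<epsilon>" if W: "isotropic W" "block_space \<iota> \<epsilon> \<subseteq> W" for W
  proof (intro equalityI W(2) subsetI)
    fix x assume x: "x \<in> W"
    have l: "x $ Inl k = \<epsilon> * x $ Inr (\<iota> k)" for k
    proof -
      have "cplx.herm (block \<iota> \<epsilon> k) x = 0"
        using W x block_in_block_space[OF assms(1)] unfolding isotropic_def hform_eq_herm by blast
      then show ?thesis using \<epsilon> herm_block[OF \<epsilon>, of \<iota> k x] by auto
    qed
    have "hform x x = 0" using W(1) x unfolding isotropic_def by blast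
    then have "(\<Sum>j\<in>- range \<iota>. cnj (x $ Inr j) * x $ Inr j) = 0"
      unfolding hform_def split l using \<epsilon> by auto
    then have "complex_of_real (\<Sum>j\<in>- range \<iota>. (cmod (x $ Inr j))\<^sup>2) = 0"
      by (simp add: complex_norm_square mult.commute del: of_real_power)
    then have "(\<Sum>j\<in>- range \<iota>. (cmod (x $ Inr j))\<^sup>2) = 0" by (simp only: of_real_eq_0_iff)
    then have "\<forall>j\<in>- range \<iota>. x $ Inr j = 0" by (subst (asm) sum_nonneg_eq_0_iff) auto
    then show "x \<in> block_space \<iota> \<epsilon>" using l by (auto simp: block_space_def)
  qed
  ultimately show ?thesis unfolding maximal_isotropic_def by blast
qed

text \<open>An unpaired coordinate vector e is orthogonal to the block space and its image under s,
  so sending e into the line of u and killing its complement is an admissible M. The quadratic term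
  of \<open>n_loop\<close> matches the term \<open>- herm w w / 2\<close> of
  \<open>eichler\<close>.\<close>

lemma eichler_in_n_loops:
  fixes \<iota> :: "'p::finite \<Rightarrow> 'q::finite" and c :: complex
  assumes "inj \<iota>" "\<epsilon> \<in> {1, - 1}" "j \<notin> range \<iota>" "c \<noteq> 0"
  shows "rat.eichler (const_vec (block \<iota> \<epsilon> i)) ((rat_const c / rat_var) *s axis (Inr j) 1) 0 \<in> n_loops"
proof -
  define u e :: "('p, 'q) cvec" where "u = block \<iota> \<epsilon> i" and "e = axis (Inr j) 1"
  have j: "\<iota> i \<noteq> j" using assms(3) by auto
  have uu: "cplx.herm u u = 0" and ue: "cplx.herm u e = 0" "cplx.herm e u = 0"
    and ee: "cplx.herm e e = 1"
    using assms(2) j unfolding u_def e_def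
    by (auto simp: herm_block cplx.herm_axis_left) (auto simp: block_def axis_def)
  have uc: "u $ Inl i = \<epsilon>" "u $ Inr j = 0" "e $ Inl i = 0" "e $ Inr j = 1"
    using j by (auto simp: u_def e_def block_def axis_def)
  have "\<epsilon> \<noteq> 0" using assms(2) by auto
  then have "u \<noteq> 0" "e \<noteq> 0" using uc by auto
  \<comment> \<open>The conjugate appears because \<open>outer u w\<close> is conjugate linear in w,
    and w is to be e times c over \<open>rat_var\<close>.\<close>
  define M where "M = cplx.outer (cnj c *s u) e"
  have N: "M - hadj M = cplx.outer (cnj c *s u) e - cplx.outer (c *s e) u"
    unfolding M_def hadj_eq_dagger cplx.dagger_outer by (simp add: cplx.outer_def vec_eq_iff mult_ac)
  have NN: "(M - hadj M) ** (M - hadj M) = cplx.outer (- (c * cnj c) *s u) u"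
    unfolding N matrix_eq matrix_vector_mul_assoc[symmetric] cplx.outer_apply matrix_vector_mult_diff_rdistrib
    by (simp add: cplx.herm_linear uu ue ee vec_eq_iff mult_ac)
  have "rank M = 1"
    unfolding M_def using \<open>u \<noteq> 0\<close> \<open>e \<noteq> 0\<close> assms(4) by (intro rank_outer) auto
  moreover have "perp_to (block_space \<iota> \<epsilon>) M"
  proof -
    have V: "vec.subspace (block_space \<iota> \<epsilon>)"
      using maximal_isotropic_block_space[OF assms(1,2)] by (simp add: maximal_isotropic_def isotropic_def)
    have "M *v x \<in> block_space \<iota> \<epsilon>" for x
      unfolding M_def cplx.outer_apply u_def
      by (intro vec.subspace_scale[OF V] block_in_block_space assms)
    moreover have "x $ Inr j = 0" if "x \<in> block_space \<iota> \<epsilon> + sgn_image (block_space \<iota> \<epsilon>)" for x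
      using that assms(3)
      by (auto simp: set_plus_def sgn_image_def sgn_mat_apply flip_def block_space_def)
    ultimately show ?thesis
      unfolding perp_to_def M_def by (simp add: cplx.outer_apply e_def cplx.herm_axis_left)
  qed
  moreover have "rank (M - hadj M) = 2"
  proof -
    let ?R = "rows (M - hadj M)"
    have row: "row k (M - hadj M) = (cnj c * u $ k) *s sg_cnj e - (c * e $ k) *s sg_cnj u" for k
      unfolding N by (simp add: row_def cplx.outer_def sg_cnj_def vec_eq_iff mult_ac)
    have "vec.span ?R = vec.span {sg_cnj e, sg_cnj u}"
    proof (rule vec.span_eq[THEN iffD2], intro conjI)
      show "?R \<subseteq> vec.span {sg_cnj e, sg_cnj u}"
        by (auto simp: rows_def row intro!: vec.span_diff vec.span_scale intro: vec.span_base)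
      have "(1 / (cnj c * \<epsilon>)) *s row (Inl i) (M - hadj M) \<in> vec.span ?R"
        "(- 1 / c) *s row (Inr j) (M - hadj M) \<in> vec.span ?R"
        by (intro vec.span_scale vec.span_base; auto simp: rows_def)+
      moreover have "(1 / (cnj c * \<epsilon>)) *s row (Inl i) (M - hadj M) = sg_cnj e"
        "(- 1 / c) *s row (Inr j) (M - hadj M) = sg_cnj u"
        using assms(4) \<open>\<epsilon> \<noteq> 0\<close> unfolding row uc by (simp_all add: vec_eq_iff)
      ultimately show "{sg_cnj e, sg_cnj u} \<subseteq> vec.span ?R" by simp
    qed
    then have "rank (M - hadj M) = vec.dim {sg_cnj e, sg_cnj u}"
      unfolding row_rank_def_gen by (rule vec.span_eq_dim)
    also have "\<dots> = 2"
    proof -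
      have "sg_cnj e \<notin> vec.span {sg_cnj u}"
      proof
        assume "sg_cnj e \<in> vec.span {sg_cnj u}"
        then obtain d where "sg_cnj e = d *s sg_cnj u" by (auto simp: vec.span_singleton)
        then have "sg_cnj e $ Inr j = d * sg_cnj u $ Inr j" by simp
        then show False by (simp add: sg_cnj_def uc)
      qed
      moreover have "sg_cnj e \<noteq> sg_cnj u" using calculation vec.span_base by fastforce
      moreover have "vec.independent {sg_cnj u}" using \<open>u \<noteq> 0\<close> by simp
      ultimately show ?thesis
        by (subst vec.dim_eq_card_independent) (simp_all add: vec.independent_insert)
    qed
    finally show ?thesis .
  qed
  moreover have "rat.eichler (const_vec u) ((rat_const c / rat_var) *s const_vec e) 0 = n_loop 0 (M - hadj M)"
    unfolding n_loop_def NN unfolding N rat_mult_diff rat_mult_outer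
    by (simp add: rat.eichler_def rat.outer_def vec_eq_iff const_vec_scale mult_ac rat.herm_linear
        herm_const_vec ee rat_const_divide rat_const_mult rat_const_minus const_vec_minus
        rat.conj_divide rat.conj_mult power2_eq_square)
  moreover have "const_vec e = axis (Inr j) 1"
    by (simp add: e_def const_vec_axis)
  ultimately show ?thesis
    unfolding n_loops_def u_def[symmetric]
    by (intro CollectI exI[of _ 0] exI[of _ M])
      (use maximal_isotropic_block_space[OF assms(1,2)] in auto)
qed

section \<open>The generators satisfy the reality condition\<close>

lemma rat_cnj_inverse_linear:
  "rat_cnj (1 / (rat_var - rat_const (of_real \<alpha>))) = 1 / (rat_var - rat_const (of_real \<alpha>))"
  by (simp add: rat.conj_divide rat.conj_diff)

lemma rat_cnj_power: "rat_cnj (f ^ k) = rat_cnj f ^ k"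
  by (induction k) (simp_all add: rat.conj_mult)

lemma lim_mat_1_plus: "lim_mat A 0 \<Longrightarrow> lim_mat (mat 1 + A) (mat 1)"
  using lim_mat_add[OF lim_mat_1, of A 0] by simp

lemma p_loops_subset_LU: "p_loops \<subseteq> LU"
proof
  fix g :: "('p::finite, 'q::finite) loop" assume "g \<in> p_loops"
  then obtain \<alpha> and l :: "('p, 'q) cvec" where l: "cplx.herm l l \<noteq> 0"
    and g: "g = rat.scaling (const_vec l) ((rat_var - rat_const \<alpha>) / (rat_var - rat_const (cnj \<alpha>)))"
    unfolding p_loops_eq by blast
  let ?h = "(rat_var - rat_const \<alpha>) / (rat_var - rat_const (cnj \<alpha>))"
  have "?h * rat_cnj ?h = 1" by (simp add: rat.conj_divide rat.conj_diff)
  then have "rat.unitary g" unfolding g using l by (intro rat.unitary_scaling) (simp_all add: herm_const_vec)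
  moreover have "lim_mat g (mat 1)"
  proof -
    have "g = mat 1 + rat_mult (?h - 1) (cplx.outer ((1 / cplx.herm l l) *s l) l)"
      unfolding g rat.scaling_def rat_mult_outer const_vec_scale herm_const_vec rat_const_divide
      by simp
    moreover have "lim_inf (?h - 1) (1 - 1)" by (intro lim_inf_diff lim_inf_linear_quotient lim_inf_1)
    ultimately show ?thesis by (simp only: lim_mat_1_plus lim_mat_rat_mult_0 diff_self)
  qed
  ultimately show "g \<in> LU" by (simp add: LU_iff)
qed

lemma q_loops_subset_LU: "q_loops \<subseteq> LU"
proof
  fix g :: "('p::finite, 'q::finite) loop" assume "g \<in> q_loops"
  then obtain \<alpha> \<beta> and u :: "('p, 'q) cvec" where u: "u \<noteq> 0" "cplx.herm u u = 0"
    and g: "g = rat.torus (const_vec u) (const_vec (flip u))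
                  ((rat_var - rat_const \<alpha>) / (rat_var - rat_const \<beta>))"
    unfolding q_loops_eq by blast
  let ?h = "(rat_var - rat_const \<alpha>) / (rat_var - rat_const \<beta>)"
  have "cplx.hyperbolic u (flip u)" using u by (intro hyperbolic_flip)
  then have "rat.hyperbolic (const_vec u) (const_vec (flip u))"
    by (simp add: rat.hyperbolic_def cplx.hyperbolic_def herm_const_vec)
  then have "rat.unitary g" unfolding g by (rule rat.unitary_torus) simp
  moreover have "lim_mat g (mat 1)"
  proof -
    define d where "d = cplx.herm u (flip u)"
    have "g = mat 1 + (rat_mult (?h - 1) (cplx.outer ((1 / d) *s u) (flip u))
        + rat_mult (1 / rat_cnj ?h - 1) (cplx.outer ((1 / d) *s flip u) u))"
      unfolding g rat.torus_def rat_mult_outer const_vec_scale herm_const_vec rat_const_divide d_def[symmetric]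
      by simp
    moreover have h1: "lim_inf (?h - 1) 0"
      using lim_inf_diff[OF lim_inf_linear_quotient lim_inf_1] by simp
    moreover have h2: "lim_inf (1 / rat_cnj ?h - 1) 0"
      using lim_inf_diff[OF lim_inf_divide[OF lim_inf_1 lim_inf_cnj[OF lim_inf_linear_quotient]] lim_inf_1]
      by simp
    ultimately show ?thesis
      using lim_mat_1_plus[OF lim_mat_add[OF lim_mat_rat_mult_0[OF h1] lim_mat_rat_mult_0[OF h2], unfolded add_0_left]]
      by metis
  qed
  ultimately show "g \<in> LU" by (simp add: LU_iff)
qed

lemma m_loops_subset_LU: "m_loops \<subseteq> LU"
proof
  fix g :: "('p::finite, 'q::finite) loop" assume "g \<in> m_loops"
  then obtain \<alpha> k N where k: "k \<in> {1, 2}" and N: "N ** N = 0" "hadj N = - N" and g: "g = m_loop \<alpha> k N"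
    unfolding m_loops_def by blast
  define f where "f = (1 / (rat_var - rat_const (of_real \<alpha>))) ^ k"
  have f: "rat_cnj f = f" unfolding f_def rat_cnj_power rat_cnj_inverse_linear ..
  have "lim_inf f (0 ^ k)" unfolding f_def by (intro lim_inf_power lim_inf_inverse_linear)
  then have "lim_inf f 0" using k by auto
  then have "lim_mat g (mat 1)"
    unfolding g m_loop_def f_def[symmetric] by (intro lim_mat_1_plus lim_mat_rat_mult_0)
  moreover have "rat.unitary g"
  proof -
    define A where "A = rat_mult f N"
    have AA: "A *v (A *v x) = 0" for x
      unfolding A_def matrix_vector_mul_assoc rat_mult_mult N(1) by simp
    have "rat.dagger g = mat 1 - A"
      unfolding g m_loop_def f_def[symmetric] A_def rat.dagger_add dagger_rat_mult f
        hadj_eq_dagger[symmetric] N(2) rat_mult_minus by simp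
    moreover have "g = mat 1 + A" unfolding g m_loop_def f_def A_def ..
    moreover have "(mat 1 - A) ** (mat 1 + A) = mat 1"
      unfolding matrix_eq matrix_vector_mul_assoc[symmetric]
      by (simp add: matrix_vector_mult_diff_rdistrib matrix_vector_mult_add_rdistrib
          matrix_vector_right_distrib AA)
    ultimately show ?thesis unfolding rat.unitary_def by simp
  qed
  ultimately show "g \<in> LU" by (simp add: LU_iff)
qed

text \<open>V + sV is stable under s, so being orthogonal to it for the indefinite form is the same
  as for the positive definite product. This allows the Euclidean orthogonal decomposition to be
  used.\<close>

lemma subspace_plus_flip_decomposition:
  fixes V :: "('p::finite, 'q::finite) cvec set"
  assumes "vec.subspace V"
  obtains y z where "y \<in> V + sgn_image V" "z \<in> perp (V + sgn_image V)" "x = y + z"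
proof -
  let ?U = "V + sgn_image V"
  have flip_linear: "flip (a + b) = flip a + flip b" "flip (c *s a) = c *s flip a" for a b :: "('p, 'q) cvec" and c
    by (simp_all add: flip_def vec_eq_iff algebra_simps)
  have flip_flip: "flip (flip a) = a" for a :: "('p, 'q) cvec"
    by (simp add: flip_def vec_eq_iff)
  have add: "a + b \<in> ?U" if U: "a \<in> ?U" "b \<in> ?U" for a b
  proof -
    obtain v w v' w' where *: "v \<in> V" "w \<in> V" "v' \<in> V" "w' \<in> V" "a = v + flip w" "b = v' + flip w'"
      using U unfolding set_plus_def sgn_image_def sgn_mat_apply by blast
    have "(v + v') + flip (w + w') \<in> ?U"
      unfolding sgn_image_def sgn_mat_apply
      by (intro set_plus_intro imageI vec.subspace_add[OF assms] *)
    then show ?thesis unfolding * by (simp add: flip_linear algebra_simps)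
  qed
  have scale: "c *s a \<in> ?U" if U: "a \<in> ?U" for a c
  proof -
    obtain v w where *: "v \<in> V" "w \<in> V" "a = v + flip w"
      using U unfolding set_plus_def sgn_image_def sgn_mat_apply by blast
    have "(c *s v) + flip (c *s w) \<in> ?U"
      unfolding sgn_image_def sgn_mat_apply
      by (intro set_plus_intro imageI vec.subspace_scale[OF assms] *)
    then show ?thesis unfolding * by (simp add: flip_linear algebra_simps)
  qed
  have flip_in: "flip a \<in> ?U" if U: "a \<in> ?U" for a
  proof -
    obtain v w where *: "v \<in> V" "w \<in> V" "a = v + flip w"
      using U unfolding set_plus_def sgn_image_def sgn_mat_apply by blast
    have "w + flip v \<in> ?U"
      unfolding sgn_image_def sgn_mat_apply by (intro set_plus_intro imageI *)
    then show ?thesis unfolding * by (simp add: flip_linear flip_flip algebra_simps)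
  qed
  have "subspace ?U"
  proof (rule subspaceI)
    have "0 + flip 0 \<in> ?U"
      unfolding sgn_image_def sgn_mat_apply by (intro set_plus_intro imageI vec.subspace_0[OF assms])
    moreover have "flip 0 = (0 :: ('p, 'q) cvec)" by (simp add: flip_def vec_eq_iff)
    ultimately show "0 \<in> ?U" by simp
    show "c *\<^sub>R a \<in> ?U" if "a \<in> ?U" for a c
    proof -
      have "c *\<^sub>R a = complex_of_real c *s a"
        by (simp add: vec_eq_iff scaleR_conv_of_real[where 'a = complex])
      then show ?thesis using scale[OF that] by metis
    qed
  qed (rule add)
  then have span: "span ?U = ?U" by (rule span_eq_iff[THEN iffD2])
  obtain y z where yz: "y \<in> span ?U" "\<And>w. w \<in> span ?U \<Longrightarrow> orthogonal z w" "x = y + z"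
    using orthogonal_subspace_decomp_exists[of ?U x] by blast
  have "cplx.herm v z = 0" if v: "v \<in> ?U" for v
  proof -
    define s where "s = (\<Sum>k\<in>UNIV. cnj (flip v $ k) * z $ k)"
    have s: "cplx.herm v z = s" unfolding s_def herm_flip[symmetric] flip_flip ..
    have Re: "inner z w = Re (\<Sum>k\<in>UNIV. cnj (w $ k) * z $ k)" for w
      by (simp add: inner_vec_def inner_complex_def mult.commute)
    have "Re s = 0"
      using yz(2)[of "flip v"] flip_in[OF v] unfolding span orthogonal_def Re s_def by simp
    \<comment> \<open>The Euclidean decomposition is real and controls only real parts; testing
      against the multiple by \<open>\<i>\<close> gives the imaginary part.\<close>
    moreover have "Re (- \<i> * s) = 0"
    proof -
      have "- \<i> * s = (\<Sum>k\<in>UNIV. cnj ((\<i> *s flip v) $ k) * z $ k)"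
        by (simp add: s_def sum_distrib_left mult_ac)
      then show ?thesis
        using yz(2)[of "\<i> *s flip v"] scale[OF flip_in[OF v]] unfolding span orthogonal_def Re by metis
    qed
    ultimately show ?thesis unfolding s by (simp add: complex_eq_iff)
  qed
  then have "z \<in> perp ?U" by (simp add: perp_def hform_eq_herm)
  then show ?thesis using that yz(1,3) span by blast
qed

text \<open>M maps everything into V and kills V, so M M = 0, and also D D = 0 for the adjoint D.
  Isotropy of V gives D M = 0. Every word of length three in M and D contains one of these
  products.\<close>

lemma cube_eq_0:
  fixes M :: "('p::finite, 'q::finite) cmat"
  assumes "isotropic V" "perp_to V M"
  defines "N \<equiv> M - hadj M"
  shows "N ** (N ** N) = 0"
proof -
  let ?D = "cplx.dagger M"
  have V: "vec.subspace V" using assms(1) by (simp add: isotropic_def)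
  have MV: "M *v x \<in> V" for x
  proof -
    obtain y z where "y \<in> V + sgn_image V" "z \<in> perp (V + sgn_image V)" "x = y + z"
      by (rule subspace_plus_flip_decomposition[OF V])
    then show ?thesis using assms(2) by (simp add: perp_to_def matrix_vector_right_distrib)
  qed
  have MM: "M *v (M *v x) = 0" for x
  proof -
    have "0 \<in> sgn_image V" using V vec.subspace_0 by (force simp: sgn_image_def)
    then have "M *v x + 0 \<in> V + sgn_image V" using MV by (intro set_plus_intro)
    then show ?thesis using assms(2) by (simp add: perp_to_def)
  qed
  have herm_nondeg: "z = 0" if "\<And>y. cplx.herm z y = 0" for z :: "('p, 'q) cvec"
    using that[of "axis _ 1"] by (simp add: cplx.herm_axis_right vec_eq_iff)
  have DM: "?D *v (M *v x) = 0" for x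
  proof (rule herm_nondeg)
    show "cplx.herm (?D *v (M *v x)) y = 0" for y
      unfolding cplx.herm_dagger
      using assms(1) MV by (simp add: isotropic_def hform_eq_herm)
  qed
  have DD: "?D *v (?D *v x) = 0" for x
  proof -
    have "M ** M = 0" unfolding matrix_eq matrix_vector_mul_assoc[symmetric] by (simp add: MM)
    then have "?D ** ?D = 0"
      by (simp add: cplx.dagger_mult[symmetric]) (simp add: cplx.dagger_def vec_eq_iff)
    then show ?thesis by (simp add: matrix_vector_mul_assoc)
  qed
  show ?thesis
    unfolding N_def hadj_eq_dagger matrix_eq matrix_vector_mul_assoc[symmetric]
    by (simp add: matrix_vector_mult_diff_rdistrib matrix_vector_mult_diff_distrib
        matrix_vector_mult_minus_right MM DM DD)
qed

text \<open>As N has cube zero, the loop is the exponential of f N with f the real function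
  \<open>1 / (rat_var - rat_const (of_real \<alpha>))\<close>, and its adjoint is the exponential of
  - f N.\<close>

lemma n_loops_subset_LU: "n_loops \<subseteq> LU"
proof
  fix g :: "('p::finite, 'q::finite) loop" assume "g \<in> n_loops"
  then obtain \<alpha> V M where V: "isotropic V" "perp_to V M" and g: "g = n_loop \<alpha> (M - hadj M)"
    unfolding n_loops_def maximal_isotropic_def by blast
  define N where "N = M - hadj M"
  have NNN: "N ** (N ** N) = 0" unfolding N_def by (rule cube_eq_0[OF V])
  have dN: "cplx.dagger N = - N"
    unfolding N_def hadj_eq_dagger by (simp add: cplx.dagger_def vec_eq_iff algebra_simps)
  define f where "f = 1 / (rat_var - rat_const (of_real \<alpha>))"
  have f: "rat_cnj f = f" unfolding f_def by (rule rat_cnj_inverse_linear)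
  have lf: "lim_inf f 0" unfolding f_def by (rule lim_inf_inverse_linear)
  define A B where "A = rat_mult f N" and "B = rat_mult (rat_const (1 / 2) * f ^ 2) (N ** N)"
  have gAB: "g = mat 1 + A + B" unfolding g n_loop_def A_def B_def f_def N_def ..
  have "lim_inf (rat_const (1 / 2) * f ^ 2) (1 / 2 * 0 ^ 2)"
    by (intro lim_inf_mult lim_inf_const lim_inf_power lf)
  then have "lim_mat (A + B) (0 + 0)"
    unfolding A_def B_def by (intro lim_mat_add lim_mat_rat_mult_0 lf) simp
  then have "lim_mat g (mat 1)" unfolding gAB by (simp add: add.assoc lim_mat_1_plus)
  moreover have "rat.unitary g"
  proof -
    have "rat.dagger A = - A" unfolding A_def dagger_rat_mult f dN rat_mult_minus ..
    moreover have "rat.dagger B = B"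
    proof -
      have "(- N) ** (- N) = N ** N" by (simp add: matrix_matrix_mult_def vec_eq_iff)
      then show ?thesis
        unfolding B_def dagger_rat_mult cplx.dagger_mult dN by (simp add: rat.conj_mult rat_cnj_power f)
    qed
    ultimately have dg: "rat.dagger g = mat 1 - A + B" unfolding gAB by (simp add: rat.dagger_add)
    have AA: "A *v (A *v x) = B *v x + B *v x" for x
    proof -
      have "f * f = rat_const (1 / 2) * f ^ 2 + rat_const (1 / 2) * f ^ 2"
        by (simp add: distrib_right[symmetric] power2_eq_square rat_const_divide)
      then have "A ** A = B + B"
        unfolding A_def B_def rat_mult_mult
        by (simp add: rat_mult_def vec_eq_iff distrib_right[symmetric])
      then show ?thesis by (simp only: matrix_vector_mul_assoc matrix_vector_mult_add_rdistrib)
    qed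
    have AB: "A *v (B *v x) = 0" "B *v (A *v x) = 0" "B *v (B *v x) = 0" for x
      unfolding A_def B_def matrix_vector_mul_assoc rat_mult_mult matrix_mul_assoc[symmetric] NNN
      by (simp_all add: matrix_mul_assoc[symmetric] NNN)
    show ?thesis
      unfolding rat.unitary_def dg unfolding gAB matrix_eq matrix_vector_mul_assoc[symmetric]
      by (simp add: matrix_vector_mult_diff_rdistrib matrix_vector_mult_add_rdistrib
          matrix_vector_right_distrib AA AB)
  qed
  ultimately show "g \<in> LU" by (simp add: LU_iff)
qed

section \<open>Unipotent elements of the generated group\<close>

lemma lim_inf_nonzero: "lim_inf f c \<Longrightarrow> c \<noteq> 0 \<Longrightarrow> f \<noteq> 0"
  using lim_inf_unique lim_inf_0 by blast

lemma lim_inf_herm: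
  fixes x y :: "ratfun ^ ('p::finite + 'q::finite)" and a b :: "complex ^ ('p + 'q)"
  assumes "\<And>k. lim_inf (x $ k) (a $ k)" "\<And>k. lim_inf (y $ k) (b $ k)"
  shows "lim_inf (rat.herm x y) (cplx.herm a b)"
  unfolding rat.herm_def cplx.herm_def
  by (intro lim_inf_sum lim_inf_mult lim_inf_cnj assms) (metis lim_inf_const rat_const_sg)

lemma lim_inf_const_vec: "lim_inf (const_vec x $ k) (x $ k)"
  by (simp add: const_vec_def lim_inf_const)

text \<open>All entries lie in the maximal ideal at infinity: the Eichler parameters compatible with
  the value I there.\<close>

definition small :: "ratfun ^ 'n \<Rightarrow> bool" where
  "small w \<longleftrightarrow> (\<forall>k. lim_inf (w $ k) 0)"

lemma small_0: "small 0"
  by (simp add: small_def lim_inf_0)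

lemma small_add: "small w \<Longrightarrow> small w' \<Longrightarrow> small (w + w')"
  using lim_inf_add[of _ 0 _ 0] by (simp add: small_def)

lemma small_minus: "small w \<Longrightarrow> small (- w)"
  using lim_inf_uminus[of _ 0] by (simp add: small_def)

lemma small_scale_const_vec: "lim_inf f 0 \<Longrightarrow> small (f *s const_vec x)"
  using lim_inf_mult[OF _ lim_inf_const_vec, of f 0 x] by (simp add: small_def)

lemma lim_inf_herm_small: "small x \<Longrightarrow> small y \<Longrightarrow> lim_inf (rat.herm x y) 0"
  using lim_inf_herm[of x 0 y 0] by (simp add: small_def)

text \<open>Rests on (1 + g)^2 - (1 - g)^2 = 4 g. In the application x is \<open>rat_var\<close>, K
  the limit of x r at infinity, and I the imaginary unit.\<close>

lemma square_difference_decomposition: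
  fixes x :: "'a::field"
  assumes "x \<noteq> 0" "I \<noteq> 0" "(4::'a) \<noteq> 0" "g = (x * r - K) / (4 * I)"
  shows "r = K / x + ((1 + g) * (1 + g) * (I / x) + (1 - g) * (1 - g) * (- I / x))"
proof -
  have g: "4 * I * g = x * r - K" using assms by simp
  have "K / x + ((1 + g) * (1 + g) * (I / x) + (1 - g) * (1 - g) * (- I / x)) = (K + 4 * I * g) / x"
    using assms(1) by (simp add: field_simps)
  also have "\<dots> = r" unfolding g using assms(1) by simp
  finally show ?thesis by simp
qed

lemma flip_block: "flip (block \<iota> \<epsilon> i) = block \<iota> (- \<epsilon>) i"
  by (simp add: flip_def block_def axis_def vec_eq_iff sg_def split: sum.split)

lemma block_nonzero: "block \<iota> \<epsilon> i \<noteq> 0"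
proof -
  have "block \<iota> \<epsilon> i $ Inr (\<iota> i) = 1" by (simp add: block_def axis_def)
  then show ?thesis by auto
qed

text \<open>Both cases of the theorem at once: \<open>surj \<iota>\<close> means that no positive
  coordinate is unpaired. Inverses enter as explicit members of the same families, with parameters
  negated or inverted.\<close>

locale loop_subgroup =
  fixes \<Gamma> :: "('p::finite, 'q::finite) loop set" and \<iota> :: "'p \<Rightarrow> 'q"
  assumes one_mem: "mat 1 \<in> \<Gamma>"
    and mult_mem: "g \<in> \<Gamma> \<Longrightarrow> h \<in> \<Gamma> \<Longrightarrow> g ** h \<in> \<Gamma>"
    and subset_LU: "\<Gamma> \<subseteq> LU"
    and p_loops: "p_loops \<subseteq> \<Gamma>"
    and q_loops: "q_loops \<subseteq> \<Gamma>"
    and m_loops: "m_loops \<subseteq> \<Gamma>"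
    and n_loops: "surj \<iota> \<or> n_loops \<subseteq> \<Gamma>"
    and inj: "inj \<iota>"
begin

lemma torus_mem:
  assumes u: "cplx.herm u u = 0" "u \<noteq> 0" and "lim_inf h 1"
  shows "rat.torus (const_vec u) (const_vec (flip u)) h \<in> \<Gamma>"
  using assms(3)
proof (induction h rule: ratfun_linear_quotient_induct)
  case one
  then show ?case by (simp add: rat.torus_1 one_mem)
next
  case (mult a b h)
  have 1: "rat.hyperbolic (const_vec u) (const_vec (flip u))"
    using hyperbolic_flip[OF u] by (simp add: rat.hyperbolic_def cplx.hyperbolic_def herm_const_vec)
  have 2: "h \<noteq> 0" using mult.hyps lim_inf_nonzero by fastforce
  have 3: "(rat_var - rat_const a) / (rat_var - rat_const b) \<noteq> 0" by simp
  have "rat.torus (const_vec u) (const_vec (flip u)) ((rat_var - rat_const a) / (rat_var - rat_const b) * h)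
      = rat.torus (const_vec u) (const_vec (flip u)) ((rat_var - rat_const a) / (rat_var - rat_const b))
        ** rat.torus (const_vec u) (const_vec (flip u)) h"
    by (rule rat.torus_mult[OF 1 3 2, symmetric])
  moreover have "rat.torus (const_vec u) (const_vec (flip u))
      ((rat_var - rat_const a) / (rat_var - rat_const b)) \<in> \<Gamma>"
    using q_loops u unfolding q_loops_eq by blast
  ultimately show ?case using mult_mem mult.IH by simp
qed

lemma eichler_conjugate_mem:
  assumes u: "cplx.herm u u = 0" "u \<noteq> 0" and w: "cplx.herm u e = 0" "cplx.herm (flip u) e = 0"
    and "lim_inf h 1" "rat.eichler (const_vec u) (f *s const_vec e) r \<in> \<Gamma>"
  shows "rat.eichler (const_vec u) ((rat_cnj h * f) *s const_vec e) (h * rat_cnj h * r) \<in> \<Gamma>"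
proof -
  have 1: "rat.hyperbolic (const_vec u) (const_vec (flip u))"
    using hyperbolic_flip[OF u] by (simp add: rat.hyperbolic_def cplx.hyperbolic_def herm_const_vec)
  have 2: "h \<noteq> 0" using assms(5) lim_inf_nonzero by fastforce
  have 3: "rat.herm (const_vec u) (f *s const_vec e) = 0" "rat.herm (const_vec (flip u)) (f *s const_vec e) = 0"
    using w by (simp_all add: rat.herm_linear herm_const_vec)
  have "rat.eichler (const_vec u) (rat_cnj h *s (f *s const_vec e)) (h * rat_cnj h * r)
     = rat.torus (const_vec u) (const_vec (flip u)) h ** rat.eichler (const_vec u) (f *s const_vec e) r
       ** rat.torus (const_vec u) (const_vec (flip u)) (1 / h)"
    by (rule rat.torus_conjugate_eichler[OF 1 3 2, symmetric])
  moreover have "lim_inf (1 / h) 1" using lim_inf_divide[OF lim_inf_1 assms(5)] by simp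
  ultimately show ?thesis
    using assms(6) torus_mem[OF u] assms(5) mult_mem by (simp add: vector_smult_assoc)
qed

text \<open>Conjugation by \<open>torus u (flip u) h\<close> multiplies \<open>r\<close> by \<open>h\<close> times its conjugate. For real \<open>g\<close>
  vanishing at infinity, the multipliers for \<open>h = 1 + g\<close> and \<open>h = 1 - g\<close> differ by \<open>4 g\<close>, so all
  transvections are obtained from those with the single simple pole \<open>0\<close>.\<close>

lemma transvection_mem:
  assumes u: "cplx.herm u u = 0" and r: "lim_inf r 0" "rat_cnj r = - r"
  shows "rat.eichler (const_vec u) 0 r \<in> \<Gamma>"
proof (cases "u = 0")
  case True
  have "rat.eichler (const_vec u) 0 r = mat 1"
    unfolding matrix_eq rat.eichler_apply using True by (simp add: const_vec_def rat.herm_def)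
  then show ?thesis by (simp add: one_mem)
next
  case False
  have uu: "rat.herm (const_vec u) (const_vec u) = 0" using u by (simp add: herm_const_vec)
  have base: "rat.eichler (const_vec u) 0 (rat_const (\<i> * of_real c) / rat_var) \<in> \<Gamma>" for c
  proof (cases "c = 0")
    case True
    then show ?thesis by (simp add: rat.eichler_0 one_mem)
  next
    case c: False
    then show ?thesis using eichler_in_m_loops[OF u False c] m_loops by blast
  qed
  have conj: "rat.eichler (const_vec u) 0 (h * rat_cnj h * (rat_const (\<i> * of_real c) / rat_var)) \<in> \<Gamma>"
    if "lim_inf h 1" for h c
    using eichler_conjugate_mem[OF u False _ _ that, of 0 0 "rat_const (\<i> * of_real c) / rat_var"] base[of c]
    by (simp del: times_divide_eq_right)
  have add: "rat.eichler (const_vec u) 0 (r1 + r2) \<in> \<Gamma>"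
    if "rat.eichler (const_vec u) 0 r1 \<in> \<Gamma>" "rat.eichler (const_vec u) 0 r2 \<in> \<Gamma>" for r1 r2
    using mult_mem[OF that] by (simp add: rat.eichler_mult uu)
  obtain k where k: "lim_inf (rat_var * r) k" using lim_inf_var_mult[OF r(1)] .
  have "rat_cnj (rat_var * r) = - (rat_var * r)" by (simp add: rat.conj_mult r(2))
  then have "cnj k = - k" using lim_inf_unique[OF lim_inf_cnj[OF k]] lim_inf_uminus[OF k] by simp
  then have k': "k = \<i> * of_real (Im k)" by (simp add: complex_eq_iff)
  \<comment> \<open>Subtracting k makes g vanish at infinity; dividing by the imaginary unit makes
    it real, since both r and k are skew.\<close>
  define g where "g = (rat_var * r - rat_const k) / (4 * rat_const \<i>)"
  have "lim_inf g ((k - k) / (4 * \<i>))"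
    unfolding g_def rat_const_numeral[symmetric] rat_const_mult[symmetric]
    by (intro lim_inf_divide lim_inf_diff k lim_inf_const) simp
  then have g: "lim_inf g 0" by simp
  have cg: "rat_cnj g = g"
    unfolding g_def using \<open>cnj k = - k\<close>
    by (simp add: rat.conj_divide rat.conj_diff rat.conj_mult r(2) rat_const_minus minus_divide_left[symmetric])
      (simp add: minus_divide_left)
  have lim: "lim_inf (1 + g) 1" "lim_inf (1 - g) 1"
    using lim_inf_add[OF lim_inf_1 g] lim_inf_diff[OF lim_inf_1 g] by simp_all
  have c: "rat_cnj (1 + g) = 1 + g" "rat_cnj (1 - g) = 1 - g"
    by (simp_all add: rat.conj_add rat.conj_diff cg)
  have "r = rat_const k / rat_var + ((1 + g) * (1 + g) * (rat_const \<i> / rat_var)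
          + (1 - g) * (1 - g) * (- rat_const \<i> / rat_var))"
    by (rule square_difference_decomposition) (simp_all add: g_def)
  moreover have "rat.eichler (const_vec u) 0 (rat_const k / rat_var) \<in> \<Gamma>"
    using base[of "Im k"] k' by simp
  moreover have "rat.eichler (const_vec u) 0 ((1 + g) * (1 + g) * (rat_const \<i> / rat_var)) \<in> \<Gamma>"
    using conj[OF lim(1), of 1] unfolding c by simp
  moreover have "rat.eichler (const_vec u) 0 ((1 - g) * (1 - g) * (- rat_const \<i> / rat_var)) \<in> \<Gamma>"
    using conj[OF lim(2), of "-1"] unfolding c by (simp add: rat_const_minus)
  ultimately show ?thesis using add by metis
qed

text \<open>Asking for all admissible r at once makes the property additive in w: the cocycle of the
  Heisenberg law can be absorbed into r.\<close>

definition good :: "('p, 'q) cvec \<Rightarrow> ratfun ^ ('p + 'q) \<Rightarrow> bool" where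
  "good u w \<longleftrightarrow> rat.herm (const_vec u) w = 0 \<and> small w \<and>
     (\<forall>r. lim_inf r 0 \<longrightarrow> rat_cnj r = - r \<longrightarrow> rat.eichler (const_vec u) w r \<in> \<Gamma>)"

lemma goodI:
  assumes u: "cplx.herm u u = 0" and w: "rat.herm (const_vec u) w = 0" "small w"
    and "rat.eichler (const_vec u) w 0 \<in> \<Gamma>"
  shows "good u w"
  unfolding good_def
proof (intro conjI w allI impI)
  fix r assume "lim_inf r 0" "rat_cnj r = - r"
  then have "rat.eichler (const_vec u) 0 r \<in> \<Gamma>" by (rule transvection_mem[OF u])
  from mult_mem[OF this assms(4)] show "rat.eichler (const_vec u) w r \<in> \<Gamma>"
    using u w by (simp add: rat.eichler_mult herm_const_vec)
qed

lemma good_add: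
  assumes u: "cplx.herm u u = 0" and w: "good u w" "good u w'"
  shows "good u (w + w')"
  unfolding good_def
proof (intro conjI allI impI)
  show "rat.herm (const_vec u) (w + w') = 0" "small (w + w')"
    using w by (auto simp: good_def rat.herm_linear intro: small_add)
  fix r assume r: "lim_inf r 0" "rat_cnj r = - r"
  \<comment> \<open>The cocycle. It is skew and vanishes at infinity, so r - s is again
    admissible.\<close>
  define s where "s = (rat.herm w' w - rat.herm w w') / 2"
  have "lim_inf s ((0 - 0) / 2)"
    unfolding s_def rat_const_numeral[symmetric]
    using w by (intro lim_inf_divide lim_inf_diff lim_inf_const lim_inf_herm_small) (auto simp: good_def)
  then have "lim_inf (r - s) (0 - 0)" by (intro lim_inf_diff r) simp
  moreover have "rat_cnj s = - s"
    by (simp add: s_def rat.conj_divide rat.conj_diff rat.conj_herm minus_divide_left)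
  ultimately have "rat.eichler (const_vec u) w (r - s) \<in> \<Gamma>"
    using w(1) r by (simp add: good_def rat.conj_diff)
  moreover have "rat.eichler (const_vec u) w' 0 \<in> \<Gamma>"
    using w(2) lim_inf_0 by (simp add: good_def)
  ultimately have "rat.eichler (const_vec u) w (r - s) ** rat.eichler (const_vec u) w' 0 \<in> \<Gamma>"
    by (rule mult_mem)
  moreover have "r - s + 0 + (rat.herm w' w - rat.herm w w') / 2 = r"
    unfolding s_def[symmetric] by simp
  ultimately show "rat.eichler (const_vec u) (w + w') r \<in> \<Gamma>"
    using w u by (simp add: rat.eichler_mult herm_const_vec good_def)
qed

lemma good_0: "cplx.herm u u = 0 \<Longrightarrow> good u 0"
  by (rule goodI) (simp_all add: small_0 rat.eichler_0 one_mem)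

text \<open>Polarization yields f = - c r with c constant and r skew. Splitting f into a skew and a
  real part reaches every f.\<close>

lemma good_isotropic:
  assumes "cplx.herm u u = 0" "cplx.herm e e = 0" "cplx.herm u e = 0" "lim_inf f 0"
  shows "good u (f *s const_vec e)"
proof -
  note h = herm_const_vec[of u u] herm_const_vec[of e e] herm_const_vec[of u e]
  have pol: "good u (- (rat_const c * r) *s const_vec e)" if r: "lim_inf r 0" "rat_cnj r = - r" for c r
  proof (rule goodI[OF assms(1)])
    show "rat.herm (const_vec u) (- (rat_const c * r) *s const_vec e) = 0"
      by (simp add: rat.herm_linear h assms)
    have "lim_inf (- (rat_const c * r)) (- (c * 0))"
      by (intro lim_inf_uminus lim_inf_mult lim_inf_const r)
    then show "small (- (rat_const c * r) *s const_vec e)"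
      by (intro small_scale_const_vec) simp
    have eq: "rat.eichler (const_vec (u + c *s e)) 0 r ** rat.eichler (const_vec u) 0 (- r)
            ** rat.eichler (const_vec e) 0 (- (rat_const c * rat_cnj (rat_const c) * r))
        = rat.eichler (const_vec u) (- (rat_const c * r) *s const_vec e) 0"
      unfolding const_vec_add const_vec_scale
      by (rule rat.eichler_polarization) (simp_all add: h assms r)
    have ue: "cplx.herm (u + c *s e) (u + c *s e) = 0"
      using assms(1-3) cplx.herm_eq_0_commute[of u e] by (simp add: cplx.herm_linear)
    have 1: "lim_inf (- r) 0" "rat_cnj (- r) = - (- r)"
      using lim_inf_uminus[OF r(1)] r(2) by (simp_all add: rat.conj_minus)
    have "lim_inf (- (rat_const c * rat_cnj (rat_const c) * r)) (- (c * cnj c * 0))"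
      by (intro lim_inf_uminus lim_inf_mult lim_inf_const lim_inf_cnj r)
    then have 2: "lim_inf (- (rat_const c * rat_cnj (rat_const c) * r)) 0" by simp
    have 3: "rat_cnj (- (rat_const c * rat_cnj (rat_const c) * r)) = - (- (rat_const c * rat_cnj (rat_const c) * r))"
      by (simp add: rat.conj_minus rat.conj_mult r mult_ac)
    show "rat.eichler (const_vec u) (- (rat_const c * r) *s const_vec e) 0 \<in> \<Gamma>"
      unfolding eq[symmetric]
      by (intro mult_mem transvection_mem ue assms r 1 2 3)
  qed
  define f1 f2 where "f1 = (f - rat_cnj f) / 2" and "f2 = (f + rat_cnj f) / 2"
  have lf: "lim_inf (rat_cnj f) 0" using lim_inf_cnj[OF assms(4)] by simp
  have "lim_inf f1 ((0 - 0) / 2)" "lim_inf f2 ((0 + 0) / 2)"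
    unfolding f1_def f2_def rat_const_numeral[symmetric]
    by (intro lim_inf_divide lim_inf_diff lim_inf_add assms lf lim_inf_const; simp)+
  then have l: "lim_inf (- f1) 0" "lim_inf (rat_const \<i> * f2) 0"
    using lim_inf_uminus[of f1 0] lim_inf_mult[OF lim_inf_const, of f2 0 \<i>] by simp_all
  have "rat_cnj f1 = - f1"
    unfolding f1_def rat.conj_divide rat.conj_diff rat.conj_conj rat.conj_2
    by (simp only: minus_divide_left minus_diff_eq)
  moreover have "rat_cnj f2 = f2"
    unfolding f2_def rat.conj_divide rat.conj_add rat.conj_conj rat.conj_2 by (simp only: add.commute)
  ultimately have "rat_cnj (- f1) = - (- f1)" "rat_cnj (rat_const \<i> * f2) = - (rat_const \<i> * f2)"
    by (simp_all add: rat.conj_minus rat.conj_mult rat_const_minus)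
  \<comment> \<open>The skew part f1 comes from c = 1 and r = - f1, the real part f2 from c =
    \<open>\<i>\<close> and r = \<open>\<i>\<close> f2, which is skew.\<close>
  note p = pol[OF l(1) this(1), of 1] pol[OF l(2) this(2), of \<i>]
  have ii: "rat_const \<i> * (rat_const \<i> * x) = - x" for x
    by (simp add: mult.assoc[symmetric] rat_const_mult[symmetric] rat_const_minus)
  have "f1 + f2 = (f + f) / 2" unfolding f1_def f2_def by (simp add: add_divide_distrib[symmetric])
  then have "f1 + f2 = f" by simp
  then have "f *s const_vec e = - (rat_const 1 * - f1) *s const_vec e
        + - (rat_const \<i> * (rat_const \<i> * f2)) *s const_vec e"
    unfolding ii by (simp add: vector_sadd_rdistrib[symmetric])
  then show ?thesis using good_add[OF assms(1) p] by simp
qed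

lemma block_orthogonal:
  assumes "\<epsilon> \<in> {1, - 1}" "\<delta> \<in> {1, - 1}" "i \<noteq> k"
  shows "cplx.herm (block \<iota> \<epsilon> i) (block \<iota> \<delta> k) = 0"
  using assms inj by (auto simp: herm_block) (auto simp: block_def axis_def inj_eq)

lemma block_isotropic: "\<epsilon> \<in> {1, - 1} \<Longrightarrow> cplx.herm (block \<iota> \<epsilon> i) (block \<iota> \<epsilon> i) = 0"
  by (auto simp: herm_block) (auto simp: block_def axis_def)

lemma block_opposite: "\<epsilon> \<in> {1, - 1} \<Longrightarrow> cplx.herm (block \<iota> \<epsilon> i) (block \<iota> (- \<epsilon>) i) = 2"
  by (auto simp: herm_block) (auto simp: block_def axis_def)

text \<open>The vector e is anisotropic, so it is reached from type (4): a seed c /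
  \<open>rat_var\<close> is multiplied by a function with value 1 at infinity through torus
  conjugation.\<close>

lemma good_positive:
  assumes \<epsilon>: "\<epsilon> \<in> {1, - 1}" and j: "j \<notin> range \<iota>" and f: "lim_inf f 0"
  shows "good (block \<iota> \<epsilon> i) (f *s axis (Inr j) 1)"
proof -
  let ?u = "block \<iota> \<epsilon> i" and ?e = "axis (Inr j) 1 :: ('p, 'q) cvec"
  have e: "axis (Inr j) 1 = const_vec ?e" by (simp add: const_vec_axis)
  note uu = block_isotropic[OF \<epsilon>, of i]
  have "\<iota> i \<noteq> j" using j by auto
  then have orth: "cplx.herm (block \<iota> \<delta> i) ?e = 0" if "\<delta> \<in> {1, - 1}" for \<delta>
    using that by (simp add: herm_block) (simp add: axis_def)
  have ue: "cplx.herm ?u ?e = 0" "cplx.herm (flip ?u) ?e = 0"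
    unfolding flip_block using \<epsilon> by (auto intro: orth)
  have main: "good ?u (f *s const_vec ?e)" if f: "lim_inf f 0" "lim_inf (rat_var * f) c" "c \<noteq> 0" for f c
  proof (rule goodI[OF uu])
    show "rat.herm (const_vec ?u) (f *s const_vec ?e) = 0"
      by (simp add: rat.herm_linear herm_const_vec ue)
    show "small (f *s const_vec ?e)" using f(1) by (rule small_scale_const_vec)
    \<comment> \<open>Conjugation multiplies w by \<open>rat_cnj h\<close>, so this h carries the
      seed to f; its value at infinity is 1 because \<open>rat_var * f\<close> tends to c.\<close>
    define h where "h = rat_cnj (rat_var * f / rat_const c)"
    have "lim_inf h (cnj (c / c))"
      unfolding h_def by (intro lim_inf_cnj lim_inf_divide f lim_inf_const)
    then have h: "lim_inf h 1" using f(3) by simp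
    have "surj \<iota> \<or> rat.eichler (const_vec ?u) ((rat_const c / rat_var) *s const_vec ?e) 0 \<in> \<Gamma>"
      using n_loops eichler_in_n_loops[OF inj \<epsilon> j f(3), of i] unfolding e by blast
    then have "rat.eichler (const_vec ?u) ((rat_const c / rat_var) *s const_vec ?e) 0 \<in> \<Gamma>"
      using j by auto
    from eichler_conjugate_mem[OF uu block_nonzero ue h this]
    have "rat.eichler (const_vec ?u) ((rat_cnj h * (rat_const c / rat_var)) *s const_vec ?e) 0 \<in> \<Gamma>"
      by simp
    moreover have "rat_cnj h * (rat_const c / rat_var) = f"
      unfolding h_def using f(3) by simp
    ultimately show "rat.eichler (const_vec ?u) (f *s const_vec ?e) 0 \<in> \<Gamma>" by simp
  qed
  obtain c where c: "lim_inf (rat_var * f) c" using lim_inf_var_mult[OF f] .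
  show ?thesis
  proof (cases "c = 0")
    case False
    then show ?thesis using main[OF f c] e by simp
  next
    case True
    \<comment> \<open>If f vanishes to higher order, no such h exists; f is then a sum of two
      functions with simple zeros at infinity.\<close>
    have "lim_inf (f + 1 / rat_var) (0 + 0)" by (intro lim_inf_add f lim_inf_inverse_var)
    moreover have "lim_inf (rat_var * (f + 1 / rat_var)) 1"
      using lim_inf_add[OF c lim_inf_1] True by (simp add: distrib_left)
    ultimately have 1: "good ?u ((f + 1 / rat_var) *s const_vec ?e)" by (intro main[of _ 1]) simp_all
    have "lim_inf (- (1 / rat_var)) (- 0)" by (intro lim_inf_uminus lim_inf_inverse_var)
    moreover have "lim_inf (rat_var * (- (1 / rat_var))) (- 1)"
      using lim_inf_uminus[OF lim_inf_1] by simp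
    ultimately have 2: "good ?u ((- (1 / rat_var)) *s const_vec ?e)" by (intro main[of _ "- 1"]) simp_all
    have "(f + 1 / rat_var) *s const_vec ?e + (- (1 / rat_var)) *s const_vec ?e = f *s const_vec ?e"
      by (simp only: vector_sadd_rdistrib[symmetric]) simp
    then show ?thesis using good_add[OF uu 1 2] e by simp
  qed
qed

lemma axis_Inl_block: "axis (Inl k) 1 = rat_const (1 / 2) *s const_vec (block \<iota> 1 k)
                         + rat_const (- 1 / 2) *s const_vec (block \<iota> (- 1) k)"
  and axis_Inr_block: "axis (Inr (\<iota> k)) 1 = rat_const (1 / 2) *s const_vec (block \<iota> 1 k)
                         + rat_const (1 / 2) *s const_vec (block \<iota> (- 1) k)"
proof -
  have "axis (Inl k) 1 = (1 / 2) *s block \<iota> 1 k + (- 1 / 2) *s block \<iota> (- 1) k"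
    "axis (Inr (\<iota> k)) 1 = (1 / 2) *s block \<iota> 1 k + (1 / 2) *s block \<iota> (- 1) k"
    by (simp_all add: vec_eq_iff block_def axis_def)
  then show "axis (Inl k) 1 = rat_const (1 / 2) *s const_vec (block \<iota> 1 k)
                         + rat_const (- 1 / 2) *s const_vec (block \<iota> (- 1) k)"
    "axis (Inr (\<iota> k)) 1 = rat_const (1 / 2) *s const_vec (block \<iota> 1 k)
                         + rat_const (1 / 2) *s const_vec (block \<iota> (- 1) k)"
    by (metis const_vec_add const_vec_axis const_vec_scale rat_const_1)+
qed

text \<open>A paired coordinate vector outside plane i is a combination of two isotropic block
  vectors orthogonal to plane i; an unpaired one is covered by \<open>good_positive\<close>.\<close>

lemma good_axis:
  assumes \<epsilon>: "\<epsilon> \<in> {1, - 1}" and k: "k \<noteq> Inl i" "k \<noteq> Inr (\<iota> i)" and f: "lim_inf f 0"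
  shows "good (block \<iota> \<epsilon> i) (f *s axis k 1)"
proof -
  have block: "good (block \<iota> \<epsilon> i) (f *s (a *s const_vec (block \<iota> 1 l) + b *s const_vec (block \<iota> (- 1) l)))"
    if "l \<noteq> i" "lim_inf a a'" "lim_inf b b'" for a b l a' b'
  proof -
    have 1: "good (block \<iota> \<epsilon> i) ((f * a) *s const_vec (block \<iota> 1 l))"
      using lim_inf_mult[OF f that(2)] that(1) \<epsilon>
      by (intro good_isotropic block_isotropic block_orthogonal) auto
    have 2: "good (block \<iota> \<epsilon> i) ((f * b) *s const_vec (block \<iota> (- 1) l))"
      using lim_inf_mult[OF f that(3)] that(1) \<epsilon>
      by (intro good_isotropic block_isotropic block_orthogonal) auto
    show ?thesis
      using good_add[OF block_isotropic[OF \<epsilon>] 1 2]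
      by (simp add: vector_add_ldistrib vector_smult_assoc)
  qed
  consider (l) l where "k = Inl l" "l \<noteq> i" | (r) l where "k = Inr (\<iota> l)" "l \<noteq> i"
    | (s) j where "k = Inr j" "j \<notin> range \<iota>"
    using k by (cases k) auto
  then show ?thesis
  proof cases
    case l
    then show ?thesis unfolding l(1) axis_Inl_block by (intro block[OF _ lim_inf_const lim_inf_const])
  next
    case r
    then show ?thesis unfolding r(1) axis_Inr_block by (intro block[OF _ lim_inf_const lim_inf_const])
  next
    case s
    then show ?thesis unfolding s(1) using \<epsilon> f by (intro good_positive)
  qed
qed

lemma good_if_small:
  assumes \<epsilon>: "\<epsilon> \<in> {1, - 1}" and w: "small w" "w $ Inl i = 0" "w $ Inr (\<iota> i) = 0"
  shows "good (block \<iota> \<epsilon> i) w"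
proof -
  have "good (block \<iota> \<epsilon> i) (\<Sum>k\<in>S. w $ k *s axis k 1)" if "finite S" for S
    using that
  proof induction
    case empty
    then show ?case using good_0 block_isotropic[OF \<epsilon>] by simp
  next
    case (insert k S)
    have "good (block \<iota> \<epsilon> i) (w $ k *s axis k 1)"
    proof (cases "k = Inl i \<or> k = Inr (\<iota> i)")
      case True
      then show ?thesis using w good_0 block_isotropic[OF \<epsilon>] by auto
    next
      case False
      then show ?thesis using w(1) \<epsilon> by (intro good_axis) (auto simp: small_def)
    qed
    then show ?case
      using good_add[OF block_isotropic[OF \<epsilon>]] insert by simp
  qed
  from this[of UNIV] show ?thesis by (simp add: basis_expansion)
qed

end

section \<open>Reduction of a loop\<close>

lemma matrix_fixing_axes:
  assumes "\<And>k. g *v axis k 1 = axis k (1 :: 'a::field)"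
  shows "g = mat 1"
proof -
  have "g *v x = x" for x
  proof -
    have "g *v x = g *v (\<Sum>k\<in>UNIV. x $ k *s axis k 1)" by (simp add: basis_expansion)
    also have "\<dots> = (\<Sum>k\<in>UNIV. x $ k *s axis k 1)"
      by (simp only: vec.linear_sum[OF matrix_vector_mul_linear_gen] vec.scale assms)
    also have "\<dots> = x" by (rule basis_expansion)
    finally show ?thesis .
  qed
  then show ?thesis by (simp add: matrix_eq)
qed

text \<open>Unitarity turns a fixed vector into a fixed linear functional, here the k-th coordinate.
  This is what protects the coordinates already treated.\<close>

lemma unitary_fixing_axis:
  assumes "rat.unitary g" "g *v axis k 1 = axis k 1"
  shows "(g *v x) $ k = x $ k"
proof -
  have "rat.herm (axis k 1) (g *v x) = rat.herm (axis k 1) x"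
    using rat.herm_unitary[OF assms(1), of "axis k 1" x] assms(2) by simp
  then show ?thesis by (simp add: rat.herm_axis_left)
qed

lemma lim_inf_LU_apply:
  assumes "g \<in> LU"
  shows "lim_inf ((g *v const_vec x) $ k) (x $ k)"
proof -
  have "lim_inf (g $ k $ l * const_vec x $ l) (mat 1 $ k $ l * x $ l)" for l
    using assms by (intro lim_inf_mult lim_inf_const_vec) (simp add: LU_iff lim_mat_def)
  then have "lim_inf ((g *v const_vec x) $ k) ((mat 1 *v x) $ k)"
    unfolding matrix_vector_mult_def by (simp add: lim_inf_sum)
  then show ?thesis by simp
qed

context loop_subgroup begin

text \<open>One elimination step: an Eichler transformation along u sends g v back to the line of v.
  F collects the coordinate vectors already fixed, which must not be disturbed.\<close>

lemma move_block_vector: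
  assumes g: "g \<in> LU" and \<epsilon>: "\<epsilon> \<in> {1, - 1}"
    and F: "\<And>k. k \<in> F \<Longrightarrow> g *v axis k 1 = axis k 1" "Inl i \<notin> F" "Inr (\<iota> i) \<notin> F"
  defines "u \<equiv> const_vec (block \<iota> (- \<epsilon>) i)" and "v \<equiv> const_vec (block \<iota> \<epsilon> i)"
  defines "a \<equiv> rat.herm u (g *v v) / 2"
  obtains \<gamma> \<gamma>' where "\<gamma> \<in> \<Gamma>" "\<gamma>' \<in> \<Gamma>" "\<gamma>' ** \<gamma> = mat 1" "\<gamma> *v u = u" "\<gamma> *v (g *v v) = a *s v"
    "\<And>k. k \<in> F \<Longrightarrow> \<gamma> *v axis k 1 = axis k 1" "lim_inf a 1"
proof -
  have \<epsilon>': "- \<epsilon> \<in> {1, - 1}" using \<epsilon> by auto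
  have U: "rat.unitary g" using g by (simp add: LU_iff)
  define x where "x = g *v v"
  define b where "b = rat.herm v x / 2"
  define w where "w = (1 / (2 * a)) *s (x - a *s v - b *s u)"
  define r where "r = - (b / a + rat.herm w w) / 2"
  have vv: "rat.herm v v = 0" and uu: "rat.herm u u = 0" and vu: "rat.herm v u = 2"
    unfolding u_def v_def herm_const_vec block_isotropic[OF \<epsilon>] block_isotropic[OF \<epsilon>'] block_opposite[OF \<epsilon>]
    by simp_all
  have uv: "cplx.herm (block \<iota> (- \<epsilon>) i) (block \<iota> \<epsilon> i) = 2"
    using block_opposite[OF \<epsilon>', of i] by simp
  have xx: "rat.herm x x = 0" unfolding x_def rat.herm_unitary[OF U] by (rule vv)
  have lx: "lim_inf (x $ k) (block \<iota> \<epsilon> i $ k)" for k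
    unfolding x_def v_def by (rule lim_inf_LU_apply[OF g])
  have two: "lim_inf 2 2" using lim_inf_const[of 2] by simp
  \<comment> \<open>The pivot: g v tends to v at infinity, so a tends to <u,v>/2 = 1 and is
    nonzero.\<close>
  have "lim_inf a (2 / 2)"
    unfolding a_def x_def[symmetric] u_def uv[symmetric]
    by (intro lim_inf_divide lim_inf_herm lim_inf_const_vec lx) (simp_all add: uv two)
  then have la: "lim_inf a 1" by simp
  then have "a \<noteq> 0" by (rule lim_inf_nonzero) simp
  have "lim_inf b (0 / 2)"
    unfolding b_def v_def block_isotropic[OF \<epsilon>, of i, symmetric]
    by (intro lim_inf_divide lim_inf_herm lim_inf_const_vec lx two) simp
  then have lb: "lim_inf b 0" by simp
  have "a = rat.herm u x / 2" by (simp add: a_def x_def)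
  note moves = rat.eichler_moves_to_line[OF vv uu vu xx, folded this b_def, folded w_def, folded r_def,
      OF \<open>a \<noteq> 0\<close>]
  have sw: "small w"
    unfolding small_def
  proof
    fix k
    have "lim_inf ((1 / (2 * a)) * (x $ k - a * v $ k - b * u $ k))
        (1 / (2 * 1) * (block \<iota> \<epsilon> i $ k - 1 * block \<iota> \<epsilon> i $ k - 0 * block \<iota> (- \<epsilon>) i $ k))"
      unfolding u_def v_def
      by (intro lim_inf_mult lim_inf_divide lim_inf_diff la lb lx lim_inf_const_vec lim_inf_1 two) simp
    moreover have "w $ k = (1 / (2 * a)) * (x $ k - a * v $ k - b * u $ k)"
      unfolding w_def by (simp only: vector_smult_component vector_minus_component)
    ultimately show "lim_inf (w $ k) 0" by (simp only: mult_1 mult_zero_left diff_self diff_zero mult_zero_right)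
  qed
  \<comment> \<open>Orthogonality to u and v, which span the plane of these two coordinates.\<close>
  have w0: "w $ Inl i = 0" "w $ Inr (\<iota> i) = 0"
  proof -
    have "rat.herm (const_vec (block \<iota> \<delta> i)) w = w $ Inr (\<iota> i) - rat_const \<delta> * w $ Inl i"
      if "\<delta> \<in> {1, - 1}" for \<delta>
      using that by (auto simp: block_def const_vec_add const_vec_axis rat.herm_linear rat.herm_axis_left
          rat_const_minus rat.conj_minus)
    from this[OF \<epsilon>] this[OF \<epsilon>'] have "w $ Inr (\<iota> i) - rat_const \<epsilon> * w $ Inl i = 0"
      "w $ Inr (\<iota> i) + rat_const \<epsilon> * w $ Inl i = 0"
      using moves(2,3) unfolding u_def v_def by (simp_all add: rat_const_minus)
    then have "w $ Inr (\<iota> i) + w $ Inr (\<iota> i) = 0" "w $ Inr (\<iota> i) = rat_const \<epsilon> * w $ Inl i"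
      by (simp_all add: algebra_simps)
    moreover have "rat_const \<epsilon> \<noteq> 0" using \<epsilon> by auto
    ultimately show "w $ Inl i = 0" "w $ Inr (\<iota> i) = 0"
      by (simp_all add: mult_2[symmetric])
  qed
  have "lim_inf r (- (0 / 1 + 0) / 2)"
    unfolding r_def
    by (intro lim_inf_divide lim_inf_uminus lim_inf_add lb la lim_inf_herm_small sw two) simp_all
  then have lr: "lim_inf r 0" by simp
  have good: "good (block \<iota> (- \<epsilon>) i) w" "good (block \<iota> (- \<epsilon>) i) (- w)"
    by (rule good_if_small[OF \<epsilon>']; simp add: sw w0 small_minus)+
  have 1: "rat.eichler u w r \<in> \<Gamma>"
    using good(1) lr moves(1) by (simp add: good_def u_def)
  have 2: "rat.eichler u (- w) (- r) \<in> \<Gamma>"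
    using good(2) lim_inf_uminus[OF lr] moves(1) by (simp add: good_def u_def rat.conj_minus)
  have 3: "rat.eichler u (- w) (- r) ** rat.eichler u w r = mat 1"
    by (rule rat.eichler_inverse[OF uu moves(2)])
  have wu: "rat.herm w u = 0" using moves(2) rat.herm_eq_0_commute by blast
  have 4: "rat.eichler u w r *v u = u"
    by (simp add: rat.eichler_apply uu wu)
  have 5: "rat.eichler u w r *v (g *v v) = a *s v"
    using moves(4) unfolding x_def .
  \<comment> \<open>Since g fixes this coordinate, g v still vanishes there, and so do u, v and
    hence w.\<close>
  have 6: "rat.eichler u w r *v axis k 1 = axis k 1" if k: "k \<in> F" for k
  proof -
    have uk: "u $ k = 0" "v $ k = 0"
      using k F(2,3) by (auto simp: u_def v_def const_vec_def block_def axis_def)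
    moreover have "x $ k = 0"
      unfolding x_def unitary_fixing_axis[OF U F(1)[OF k]] by (rule uk)
    ultimately have "w $ k = 0" by (simp add: w_def)
    then show ?thesis by (simp add: rat.eichler_apply rat.herm_axis_right uk)
  qed
  show ?thesis using that 1 2 3 4 5 6 la by blast
qed

text \<open>Induction on the set C of planes not yet fixed: each step multiplies g by elements of
  \<open>\<Gamma>\<close> with inverses in \<open>\<Gamma>\<close> until one more plane is fixed
  pointwise.\<close>

lemma mem_if_fixes_blocks:
  assumes base: "\<And>g. g \<in> LU \<Longrightarrow> (\<And>i. g *v axis (Inl i) 1 = axis (Inl i) 1) \<Longrightarrow>
      (\<And>i. g *v axis (Inr (\<iota> i)) 1 = axis (Inr (\<iota> i)) 1) \<Longrightarrow> g \<in> \<Gamma>"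
    and g: "g \<in> LU"
  shows "g \<in> \<Gamma>"
proof -
  have "g \<in> \<Gamma>" if "finite C" "g \<in> LU" "\<And>i. i \<notin> C \<Longrightarrow> g *v axis (Inl i) 1 = axis (Inl i) 1"
    "\<And>i. i \<notin> C \<Longrightarrow> g *v axis (Inr (\<iota> i)) 1 = axis (Inr (\<iota> i)) 1" for C g
    using that
  proof (induction C arbitrary: g)
    case empty
    then show ?case by (intro base) auto
  next
    case (insert i C)
    define F where "F = Inl ` (- insert i C) \<union> Inr ` \<iota> ` (- insert i C)"
    have iF: "Inl i \<notin> F" "Inr (\<iota> i) \<notin> F" using inj by (auto simp: F_def inj_eq)
    have gF: "g *v axis k 1 = axis k 1" if "k \<in> F" for k
      using that insert.prems by (auto simp: F_def)
    define v u where "v = const_vec (block \<iota> 1 i)" and "u = const_vec (block \<iota> (- 1) i)"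
    note hg = insert.prems(1)
    have e: "1 \<in> {1, - 1 :: complex}" "- 1 \<in> {1, - 1 :: complex}" by auto
    obtain \<gamma>1 \<gamma>1' a where 1: "\<gamma>1 \<in> \<Gamma>" "\<gamma>1' \<in> \<Gamma>" "\<gamma>1' ** \<gamma>1 = mat 1" "\<gamma>1 *v (g *v v) = a *s v"
      "\<And>k. k \<in> F \<Longrightarrow> \<gamma>1 *v axis k 1 = axis k 1" "lim_inf a 1"
      using move_block_vector[OF hg e(1) gF iF] unfolding v_def by metis
    have a: "a \<noteq> 0" using 1(6) by (rule lim_inf_nonzero) simp
    \<comment> \<open>Normalizes the pivot, so that v itself becomes fixed.\<close>
    define T T' where "T = rat.torus v u (1 / a)" and "T' = rat.torus v u a"
    have T': "T' \<in> \<Gamma>"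
      using torus_mem[OF block_isotropic[OF e(1)] block_nonzero 1(6), of i]
      unfolding T'_def v_def u_def flip_block .
    have "lim_inf (1 / a) (1 / 1)" by (intro lim_inf_divide lim_inf_1 1(6)) simp
    then have T: "T \<in> \<Gamma>"
      using torus_mem[OF block_isotropic[OF e(1)] block_nonzero, of "1 / a" i]
      unfolding T_def v_def u_def flip_block by simp
    have vu: "rat.herm v u = 2"
      unfolding v_def u_def herm_const_vec block_opposite[OF e(1)] by simp
    have hyp: "rat.hyperbolic v u"
      using hyperbolic_flip[OF block_isotropic[OF e(1)] block_nonzero, of i]
      unfolding v_def u_def flip_block by (simp add: rat.hyperbolic_def cplx.hyperbolic_def herm_const_vec)
    have TT: "T' ** T = mat 1"
      unfolding T_def T'_def using rat.torus_mult[OF hyp a, of "1 / a"] a by (simp add: rat.torus_1)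
    have Tv: "T *v (a *s v) = v"
      using a unfolding vec.scale T_def rat.torus_scale[OF hyp] by simp
    have ukF: "u $ k = 0" "v $ k = 0" if "k \<in> F" for k
      using that iF by (auto simp: u_def v_def const_vec_def block_def axis_def)
    have TF: "T *v axis k 1 = axis k 1" if "k \<in> F" for k
      unfolding T_def using ukF[OF that] by (intro rat.torus_fix) (simp_all add: rat.herm_axis_right)
    define g2 where "g2 = T ** (\<gamma>1 ** g)"
    have g2: "g2 \<in> LU" unfolding g2_def using T 1(1) subset_LU hg by (blast intro: LU_mult)
    have g2v: "g2 *v v = v"
      unfolding g2_def matrix_vector_mul_assoc[symmetric] 1(4) Tv ..
    have g2F: "g2 *v axis k 1 = axis k 1" if "k \<in> F" for k
      unfolding g2_def matrix_vector_mul_assoc[symmetric] gF[OF that] 1(5)[OF that] TF[OF that] ..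
    \<comment> \<open>As v is fixed, the second pivot is exactly 1. The second elimination exchanges
      u and v, so its Eichler transformation fixes v and sends g2 u to u without a further torus
      factor.\<close>
    have "rat.herm v (g2 *v u) = 2"
      using rat.herm_unitary[of g2 v u] g2 g2v vu by (simp add: LU_iff)
    then have au: "rat.herm (const_vec (block \<iota> (- (- 1)) i)) (g2 *v const_vec (block \<iota> (- 1) i)) / 2 = 1"
      unfolding v_def u_def by simp
    obtain \<gamma>2 \<gamma>2' where 2: "\<gamma>2 \<in> \<Gamma>" "\<gamma>2' \<in> \<Gamma>" "\<gamma>2' ** \<gamma>2 = mat 1" "\<gamma>2 *v v = v" "\<gamma>2 *v (g2 *v u) = u"
      "\<And>k. k \<in> F \<Longrightarrow> \<gamma>2 *v axis k 1 = axis k 1"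
      using move_block_vector[OF g2 e(2) g2F iF, unfolded au, folded u_def]
      unfolding v_def by (metis minus_minus vector_smult_lid)
    define g3 where "g3 = \<gamma>2 ** g2"
    have g3: "g3 \<in> LU" unfolding g3_def using 2(1) subset_LU g2 by (blast intro: LU_mult)
    have g3uv: "g3 *v u = u" "g3 *v v = v"
      unfolding g3_def matrix_vector_mul_assoc[symmetric] g2v by (simp_all add: 2)
    have g3i: "g3 *v axis (Inl i) 1 = axis (Inl i) 1" "g3 *v axis (Inr (\<iota> i)) 1 = axis (Inr (\<iota> i)) 1"
      unfolding axis_Inl_block axis_Inr_block v_def[symmetric] u_def[symmetric]
      by (simp_all only: matrix_vector_right_distrib vec.scale g3uv)
    have g3F: "g3 *v axis k 1 = axis k 1" if "k \<in> F" for k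
      unfolding g3_def matrix_vector_mul_assoc[symmetric] g2F[OF that] 2(6)[OF that] ..
    have "g3 \<in> \<Gamma>"
    proof (rule insert.IH[OF g3])
      fix k assume "k \<notin> C"
      then show "g3 *v axis (Inl k) 1 = axis (Inl k) 1" "g3 *v axis (Inr (\<iota> k)) 1 = axis (Inr (\<iota> k)) 1"
        using g3i g3F by (cases "k = i"; simp add: F_def)+
    qed
    then have "\<gamma>1' ** (T' ** (\<gamma>2' ** g3)) \<in> \<Gamma>"
      by (intro mult_mem 1 2 T')
    moreover have "\<gamma>2' ** g3 = g2" "T' ** g2 = \<gamma>1 ** g" "\<gamma>1' ** (\<gamma>1 ** g) = g"
      by (simp_all add: g3_def g2_def matrix_mul_assoc 1(3) 2(3) TT)
    ultimately show ?case by simp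
  qed
  from this[of UNIV g] show ?thesis using g by simp
qed

end

section \<open>Removing poles in the definite part\<close>

lemma to_fract_smult: "to_fract (smult c p) = rat_const c * to_fract p"
  by (simp add: rat_const_def flip: to_fract_mult)

lemma to_fract_sg [simp]: "to_fract (sg k) = sg k"
  by (cases k) simp_all

lemma poly_sg [simp]: "poly (sg k) z = sg k"
  by (cases k) simp_all

lemma common_denominator:
  fixes x :: "ratfun ^ 'n::finite"
  obtains D where "D \<noteq> 0" "\<And>k. \<exists>p. to_fract D * x $ k = to_fract p"
proof -
  have "\<exists>b a. b \<noteq> 0 \<and> x $ k = to_fract a / to_fract b" for k
    by (metis ratfun_quotient_cases)
  then obtain b a where ba: "\<And>k. b k \<noteq> 0" "\<And>k. x $ k = to_fract (a k) / to_fract (b k)" by metis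
  have "to_fract (\<Prod>k\<in>UNIV. b k) * x $ k = to_fract ((\<Prod>k\<in>UNIV - {k}. b k) * a k)" for k
    using ba(1)[of k] by (simp add: ba(2) prod.remove[of UNIV k])
  then show ?thesis using that[of "\<Prod>k\<in>UNIV. b k"] ba(1) by (metis finite prod_zero_iff)
qed

text \<open>If \<open>\<alpha>\<close> is a zero of the common denominator of a unit vector \<open>x = X / D\<close> and \<open>l = X(\<alpha>)\<close>, then
  \<open>X(\<alpha>)\<close> and \<open>X(\<alpha>\<^sup>*)\<close> are orthogonal, so the loop of type (1) for the line through \<open>l\<close>
  cancels the zero \<open>\<alpha>\<close> without introducing the pole \<open>\<alpha>\<^sup>*\<close>.\<close>

lemma scaling_removes_pole:
  fixes x :: "ratfun ^ ('p::finite + 'q::finite)"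
  assumes X: "\<And>k. to_fract ([:- \<alpha>, 1:] * D) * x $ k = to_fract (X k)"
    and x: "rat.herm x x = 1"
    and l: "l = (\<chi> k. poly (X k) \<alpha>)" "cplx.herm l l \<noteq> 0"
  defines "h \<equiv> (rat_var - rat_const \<alpha>) / (rat_var - rat_const (cnj \<alpha>))"
  shows "\<exists>p. to_fract D * (rat.scaling (const_vec l) h *v x) $ k = to_fract p"
proof -
  define E where "E = [:- \<alpha>, 1:] * D"
  define d where "d = cplx.herm l l"
  define Y where "Y = (\<Sum>k\<in>UNIV. smult (sg k * cnj (l $ k)) (X k))"
  \<comment> \<open>Clearing denominators in <x,x> = 1 gives a polynomial identity. At
    \<open>cnj \<alpha>\<close> its right side vanishes, and its left side is the product of l with
    the value of X there.\<close>
  have "to_fract (\<Sum>k\<in>UNIV. sg k * map_poly cnj (X k) * X k)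
      = (\<Sum>k\<in>UNIV. sg k * rat_cnj (to_fract E * x $ k) * (to_fract E * x $ k))"
    unfolding X[folded E_def] rat_cnj_to_fract by simp
  also have "\<dots> = rat_cnj (to_fract E) * to_fract E * rat.herm x x"
    by (simp add: rat.herm_def sum_distrib_left rat.conj_mult mult_ac)
  also have "\<dots> = to_fract (map_poly cnj E * E)"
    by (simp add: x rat_cnj_to_fract)
  finally have "(\<Sum>k\<in>UNIV. sg k * map_poly cnj (X k) * X k) = map_poly cnj E * E"
    by (simp only: to_fract_eq_iff)
  then have "poly (\<Sum>k\<in>UNIV. sg k * map_poly cnj (X k) * X k) (cnj \<alpha>) = poly (map_poly cnj E * E) (cnj \<alpha>)"
    by simp
  then have "poly Y (cnj \<alpha>) = 0"
    by (simp add: poly_sum Y_def l(1) E_def)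
  then obtain Z where Z: "Y = [:- cnj \<alpha>, 1:] * Z" by (auto simp: poly_eq_0_iff_dvd)
  have "poly Y \<alpha> = d" by (simp add: Y_def poly_sum d_def cplx.herm_def l(1))
  \<comment> \<open>As d is nonzero, \<open>\<alpha>\<close> cannot be real: a real zero of the
    denominator forces l to be isotropic.\<close>
  then have Za: "(\<alpha> - cnj \<alpha>) * poly Z \<alpha> = d" unfolding Z by (simp add: left_diff_distrib)
  have d: "d \<noteq> 0" unfolding d_def by (rule l(2))
  \<comment> \<open>The k-th numerator after applying the loop: its denominator
    \<open>[:- cnj \<alpha>, 1:]\<close> has cancelled against Y, and N vanishes at
    \<open>\<alpha>\<close> because the loop kills l there.\<close>
  define N where "N = X k + smult ((cnj \<alpha> - \<alpha>) * l $ k / d) Z"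
  have "poly N \<alpha> = l $ k - (\<alpha> - cnj \<alpha>) * poly Z \<alpha> * (l $ k / d)"
    by (simp add: N_def l(1) algebra_simps diff_divide_distrib)
  then have "poly N \<alpha> = 0" unfolding Za using d by simp
  then obtain Q where Q: "N = [:- \<alpha>, 1:] * Q" by (auto simp: poly_eq_0_iff_dvd)
  define A B where "A = rat_var - rat_const \<alpha>" and "B = rat_var - rat_const (cnj \<alpha>)"
  have A: "to_fract [:- \<alpha>, 1:] = A" and B: "to_fract [:- cnj \<alpha>, 1:] = B"
    unfolding A_def B_def rat_var_minus_const by simp_all
  have AB: "A \<noteq> 0" "B \<noteq> 0" by (simp_all add: A_def B_def)
  have h1: "(h - 1) * B = rat_const (cnj \<alpha> - \<alpha>)"
  proof -
    have "(h - 1) * B = A - B"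
      unfolding h_def A_def[symmetric] B_def[symmetric] using AB by (simp add: left_diff_distrib)
    also have "\<dots> = rat_const (cnj \<alpha> - \<alpha>)" by (simp add: A_def B_def rat_const_diff)
    finally show ?thesis .
  qed
  have HY: "to_fract E * rat.herm (const_vec l) x = to_fract Y"
    unfolding Y_def rat.herm_def sum_distrib_left to_fract_sum to_fract_smult X[folded E_def, symmetric]
    by (simp add: const_vec_def rat_const_mult mult_ac)
  have "A * (to_fract D * (rat.scaling (const_vec l) h *v x) $ k)
      = to_fract E * (x $ k + ((h - 1) / rat_const d * rat.herm (const_vec l) x) * rat_const (l $ k))"
    unfolding rat.scaling_apply herm_const_vec d_def E_def to_fract_mult A
    by (simp add: const_vec_def)
  also have "\<dots> = to_fract E * x $ k
      + (h - 1) / rat_const d * (to_fract E * rat.herm (const_vec l) x) * rat_const (l $ k)"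
    by (simp only: distrib_left mult_ac)
  also have "\<dots> = to_fract (X k) + (h - 1) / rat_const d * (B * to_fract Z) * rat_const (l $ k)"
    unfolding HY X[folded E_def] Z to_fract_mult B ..
  also have "\<dots> = to_fract (X k) + ((h - 1) * B) * rat_const (l $ k) / rat_const d * to_fract Z"
    by (simp only: times_divide_eq_left times_divide_eq_right mult_ac)
  also have "\<dots> = to_fract N"
    unfolding h1 N_def to_fract_add to_fract_smult rat_const_divide rat_const_mult ..
  also have "\<dots> = A * to_fract Q"
    unfolding Q to_fract_mult A ..
  finally show ?thesis using AB(1) by (metis mult_cancel_left)
qed

context loop_subgroup begin

lemma scaling_mem:
  "cplx.herm l l \<noteq> 0 \<Longrightarrow>
    rat.scaling (const_vec l) ((rat_var - rat_const \<alpha>) / (rat_var - rat_const (cnj \<alpha>))) \<in> \<Gamma>"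
  using p_loops unfolding p_loops_eq by blast

text \<open>Two nested inductions: over the set J of positive coordinate vectors possibly still
  moved, and over the degree of a common denominator of one column.\<close>

lemma mem_if_fixes_negative:
  assumes g: "g \<in> LU" and fixes_Inl: "\<And>i. g *v axis (Inl i) 1 = axis (Inl i) 1"
  shows "g \<in> \<Gamma>"
proof -
  have "g \<in> \<Gamma>" if "finite J" "g \<in> LU" "\<And>k. k \<notin> Inr ` J \<Longrightarrow> g *v axis k 1 = axis k 1" for J g
    using that
  proof (induction J arbitrary: g)
    case empty
    then have "g = mat 1" by (intro matrix_fixing_axes) simp
    then show ?case using one_mem by simp
  next
    case (insert j J)
    define e :: "ratfun ^ ('p + 'q)" where "e = axis (Inr j) 1"
    have descent: "g \<in> \<Gamma>"
      if "degree D = n" "D \<noteq> 0" "g \<in> LU" "\<And>k. k \<notin> Inr ` insert j J \<Longrightarrow> g *v axis k 1 = axis k 1"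
        "\<And>k. \<exists>p. to_fract D * (g *v e) $ k = to_fract p" for D n g
      using that
    proof (induction n arbitrary: D g)
      case 0
      obtain c where D: "D = [:c:]" "c \<noteq> 0"
        using 0 by (metis degree_eq_zeroE pCons_0_0)
      have "(g *v e) $ k = e $ k" for k
      proof -
        obtain p where "to_fract D * (g *v e) $ k = to_fract p" using 0 by metis
        then have "rat_const (1 / c) * (rat_const c * (g *v e) $ k) = to_fract (smult (1 / c) p)"
          by (simp add: D(1) to_fract_smult rat_const_def)
        then have p: "(g *v e) $ k = to_fract (smult (1 / c) p)"
          using D(2) by (simp add: mult.assoc[symmetric] rat_const_mult[symmetric])
        have e: "e = const_vec (axis (Inr j) 1)" by (simp add: e_def const_vec_axis)
        have "lim_inf ((g *v e) $ k) (axis (Inr j) 1 $ k)"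
          unfolding e by (rule lim_inf_LU_apply[OF 0(3)])
        \<comment> \<open>A column without poles is polynomial, and finiteness at infinity makes it
          constant, equal to its limit.\<close>
        then have "to_fract (smult (1 / c) p) = rat_const (axis (Inr j) 1 $ k)"
          unfolding p by (rule lim_inf_polynomial_constant)
        moreover have "e $ k = rat_const (axis (Inr j) 1 $ k)" by (simp add: e const_vec_def)
        ultimately show ?thesis using p by simp
      qed
      then have "g *v e = e" by (simp add: vec_eq_iff)
      then have "g *v axis k 1 = axis k 1" if "k \<notin> Inr ` J" for k
        using 0(4)[of k] that unfolding e_def by blast
      then show ?case using insert.IH 0(3) by blast
    next
      case (Suc n)
      define x where "x = g *v e"
      have U: "rat.unitary g" using Suc.prems(3) by (simp add: LU_iff)
      obtain X where X: "\<And>k. to_fract D * x $ k = to_fract (X k)"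
        using Suc.prems(5) unfolding x_def by metis
      obtain \<alpha> where "poly D \<alpha> = 0"
        using fundamental_theorem_of_algebra[of D] Suc.prems(1) by (auto simp: constant_degree)
      then obtain D' where D': "D = [:- \<alpha>, 1:] * D'" by (auto simp: poly_eq_0_iff_dvd)
      have "D' \<noteq> 0" using Suc.prems(2) D' by auto
      then have "degree D' = n"
        using Suc.prems(1) unfolding D' by (simp add: degree_mult_eq del: mult_pCons_left)
      note IH = Suc.IH[OF this \<open>D' \<noteq> 0\<close>]
      define l where "l = (\<chi> k. poly (X k) \<alpha>)"
      show ?case
      proof (cases "l = 0")
        \<comment> \<open>The common denominator was not reduced: \<open>\<alpha>\<close> is a zero
          of all numerators and cancels without any loop.\<close>
        case True
        have "\<exists>p. to_fract D' * x $ k = to_fract p" for k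
        proof -
          have "poly (X k) \<alpha> = 0" using True by (simp add: l_def vec_eq_iff)
          then obtain p where "X k = [:- \<alpha>, 1:] * p" by (auto simp: poly_eq_0_iff_dvd)
          then have "to_fract [:- \<alpha>, 1:] * (to_fract D' * x $ k) = to_fract [:- \<alpha>, 1:] * to_fract p"
            using X[of k] unfolding D' by (simp only: to_fract_mult mult.assoc)
          moreover have "to_fract [:- \<alpha>, 1:] \<noteq> 0" by simp
          ultimately show ?thesis by (metis mult_cancel_left)
        qed
        then show ?thesis using IH Suc.prems(3,4) unfolding x_def by blast
      next
        case False
        have l0: "l $ k = 0" if k: "k \<notin> Inr ` insert j J" for k
        proof -
          have "x $ k = 0"
            unfolding x_def unitary_fixing_axis[OF U Suc.prems(4)[OF k]] using k by (auto simp: e_def axis_def)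
          then have "X k = 0" using X[of k] by simp
          then show ?thesis by (simp add: l_def)
        qed
        \<comment> \<open>l is supported on positive coordinates, where the form agrees with the
          positive definite product; hence l is anisotropic.\<close>
        have "cplx.herm l l = cplx.herm (flip l) l"
          unfolding cplx.herm_def
        proof (rule sum.cong[OF refl])
          fix k :: "'p + 'q"
          show "sg k * cnj (l $ k) * l $ k = sg k * cnj (flip l $ k) * l $ k"
            using l0[of k] by (cases k) (auto simp: flip_def)
        qed
        then have ll: "cplx.herm l l \<noteq> 0" using False by (simp add: herm_flip_self_eq_0_iff)
        have xx: "rat.herm x x = 1"
          unfolding x_def rat.herm_unitary[OF U] by (simp add: e_def rat.herm_axis_left)
        define \<gamma> where "\<gamma> = rat.scaling (const_vec l) ((rat_var - rat_const \<alpha>) / (rat_var - rat_const (cnj \<alpha>)))"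
        \<comment> \<open>The inverse of \<open>\<gamma>\<close> is again a loop of type (1), with
          \<open>cnj \<alpha>\<close> in place of \<open>\<alpha>\<close>.\<close>
        define \<gamma>' where "\<gamma>' = rat.scaling (const_vec l) ((rat_var - rat_const (cnj \<alpha>)) / (rat_var - rat_const \<alpha>))"
        have mem: "\<gamma> \<in> \<Gamma>" "\<gamma>' \<in> \<Gamma>"
          using scaling_mem[OF ll, of \<alpha>] scaling_mem[OF ll, of "cnj \<alpha>"] by (simp_all add: \<gamma>_def \<gamma>'_def)
        have "rat.herm (const_vec l) (const_vec l) \<noteq> 0" using ll by (simp add: herm_const_vec)
        then have inverse: "\<gamma>' ** \<gamma> = mat 1"
          unfolding \<gamma>_def \<gamma>'_def by (simp add: rat.scaling_mult rat.scaling_1)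
        have "\<gamma> ** g \<in> \<Gamma>"
        proof (rule IH)
          show "\<gamma> ** g \<in> LU" using mem(1) subset_LU Suc.prems(3) by (blast intro: LU_mult)
          show "(\<gamma> ** g) *v axis k 1 = axis k 1" if k: "k \<notin> Inr ` insert j J" for k
            unfolding matrix_vector_mul_assoc[symmetric] Suc.prems(4)[OF k] \<gamma>_def rat.scaling_apply
            using l0[OF k] by (simp add: rat.herm_axis_right const_vec_def)
          show "\<exists>p. to_fract D' * ((\<gamma> ** g) *v e) $ k = to_fract p" for k
            unfolding matrix_vector_mul_assoc[symmetric] x_def[symmetric] \<gamma>_def
            by (rule scaling_removes_pole[OF X[unfolded D'] xx l_def ll])
        qed
        then have "\<gamma>' ** (\<gamma> ** g) \<in> \<Gamma>" by (rule mult_mem[OF mem(2)])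
        then show ?thesis by (simp add: matrix_mul_assoc inverse)
      qed
    qed
    obtain D where "D \<noteq> 0" "\<And>k. \<exists>p. to_fract D * (g *v e) $ k = to_fract p"
      using common_denominator[of "g *v e"] by blast
    then show ?case using descent[OF refl] insert.prems by blast
  qed
  from this[of UNIV g] show ?thesis
  proof
    show "g *v axis k 1 = axis k 1" if "k \<notin> Inr ` UNIV" for k
      using that fixes_Inl by (cases k) auto
  qed (simp_all add: g)
qed

lemma LU_subset: "LU \<subseteq> \<Gamma>"
  using mem_if_fixes_blocks mem_if_fixes_negative by blast

end

lemma generate_eq_LU:
  fixes S :: "('p::finite, 'q::finite) loop set" and \<iota> :: "'p \<Rightarrow> 'q"
  assumes "p_loops \<union> q_loops \<union> m_loops \<subseteq> S" "S \<subseteq> LU" "inj \<iota>" "surj \<iota> \<or> n_loops \<subseteq> S"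
  shows "generate LGL S = LU"
proof -
  have incl: "S \<subseteq> generate LGL S" by (auto intro: generate.incl)
  interpret loop_subgroup "generate LGL S" \<iota>
    using assms incl generate_subset_LU[OF assms(2)]
    by unfold_locales (auto intro: generate_LGL_one generate_LGL_mult)
  show ?thesis using LU_subset subset_LU by blast
qed

theorem theorem4p2:
  assumes "CARD('p::finite) \<le> CARD('q::finite)"
  shows "(CARD('p) = CARD('q) \<longrightarrow>
            generate LGL (p_loops \<union> q_loops \<union> m_loops) = (LU :: ('p, 'q) loop set)) \<and>
         (CARD('p) \<noteq> CARD('q) \<longrightarrow>
            generate LGL (p_loops \<union> q_loops \<union> m_loops \<union> n_loops) = (LU :: ('p, 'q) loop set))"
proof -
  obtain \<iota> :: "'p \<Rightarrow> 'q" where inj: "inj \<iota>"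
    using assms card_le_inj[of "UNIV :: 'p set" "UNIV :: 'q set"] by auto
  note subsets = p_loops_subset_LU q_loops_subset_LU m_loops_subset_LU n_loops_subset_LU
  show ?thesis
  proof (intro conjI impI)
    assume "CARD('p) = CARD('q)"
    then have "card (range \<iota>) = CARD('q)" using inj by (simp add: card_image)
    then have "surj \<iota>" by (simp add: card_subset_eq)
    then show "generate LGL (p_loops \<union> q_loops \<union> m_loops) = (LU :: ('p, 'q) loop set)"
      using subsets inj by (intro generate_eq_LU[of _ \<iota>]) auto
  next
    show "generate LGL (p_loops \<union> q_loops \<union> m_loops \<union> n_loops) = (LU :: ('p, 'q) loop set)"
      using subsets inj by (intro generate_eq_LU[of _ \<iota>]) auto
  qed
qed

end
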